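(* Let $L$ be any language in $\mathsf{DLIN}$ over a finite alphabet $\Sigma$. Then: (1) there is a randomized one-pass streaming algorithm using $O(\log n)$ space such that for every input $x \in \Sigma^n$: if $x \in L$ the algorithm accepts with probability $1$, and if $x \notin L$ the algorithm rejects with probability at least $1-\frac{1}{n}$; (2) for every positive integer $p$, there is a deterministic $p$-pass streaming algorithm using $O(n/p)$ space that tests membership in $L$ for inputs of length $n$.
   Context: A deterministic linear context-free grammar (DL-CFG) is a context-free grammar $(\Sigma, N, P, S)$ in which every production has the form $A \rightarrow a\omega$ or $A \rightarrow \epsilon$, with $a \in \Sigma$ and $\omega \in (N \cup \{\epsilon\})\Sigma^*$, and such that for any two productions $A \rightarrow a\omega$ and $A \rightarrow b\omega'$ with the same left-hand side $A$ (and $a,b\in\Sigma$), we have $a \neq b$. $\mathsf{DLIN}$ is the class of languages generated by some DL-CFG. A $p$-pass streaming algorithm reads its input string sequentially from left to right $p$ times, knows the input length $n$, and its space is the number of bits of working memory it uses; a randomized streaming algorithm may additionally use random bits. *)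

theory Defs
  imports "HOL-Probability.Probability" "HOL-Library.Landau_Symbols" "HOL-Library.Log_Nat"
begin

section \<open>Deterministic linear context-free grammars\<close>

datatype ('a, 'n) symbol = Tm 'a | Nt 'n

record ('a, 'n) cfg =
  terms :: "'a set"
  nonterms :: "'n set"
  prods :: "('n \<times> ('a, 'n) symbol list) set"
  start :: 'n

definition is_cfg :: "('a, 'n) cfg \<Rightarrow> bool" where
  "is_cfg G \<longleftrightarrow>
     finite (terms G) \<and> finite (nonterms G) \<and> finite (prods G) \<and> start G \<in> nonterms G \<and>
     prods G \<subseteq> nonterms G \<times> lists (Tm ` terms G \<union> Nt ` nonterms G)"

inductive derives1 ::
    "('a, 'n) cfg \<Rightarrow> ('a, 'n) symbol list \<Rightarrow> ('a, 'n) symbol list \<Rightarrow> bool" for G where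
  "(A, w) \<in> prods G \<Longrightarrow> derives1 G (u @ [Nt A] @ v) (u @ w @ v)"

definition language :: "('a, 'n) cfg \<Rightarrow> 'a list set" where
  "language G = {x. (derives1 G)\<^sup>*\<^sup>* [Nt (start G)] (map Tm x)}"

definition is_dl_cfg :: "('a, 'n) cfg \<Rightarrow> bool" where
  "is_dl_cfg G \<longleftrightarrow>
     is_cfg G \<and>
     (\<forall>(A, w) \<in> prods G.
        w = [] \<or>
        (\<exists>a \<omega>. w = Tm a # \<omega> \<and> (\<exists>u. \<omega> = map Tm u \<or> (\<exists>B. \<omega> = Nt B # map Tm u)))) \<and>
     (\<forall>A a b \<omega> \<omega>'.
        (A, Tm a # \<omega>) \<in> prods G \<longrightarrow> (A, Tm b # \<omega>') \<in> prods G \<longrightarrow>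
        Tm a # \<omega> \<noteq> Tm b # \<omega>' \<longrightarrow> a \<noteq> b)"

text \<open>
  The set of nonterminals is finite, so drawing them from \<^typ>\<open>nat\<close> is only a choice of names.
\<close>

definition DLIN :: "'a set \<Rightarrow> 'a list set set" where
  "DLIN A = {language G | G :: ('a, nat) cfg. is_dl_cfg G \<and> terms G = A}"


section \<open>Streaming algorithms\<close>

text \<open>
  An algorithm is one finite program, the same for all input lengths. Its working memory
  consists of a fixed number of registers holding natural numbers, and the space is the total
  number of binary digits. The bound is imposed on every store that occurs during a run, also
  between two reads. Each arithmetic instruction can be carried out by a Turing machine in space
  linear in the number of bits of its operands and result, so up to a constant factor this is
  Turing machine space.
\<close>

datatype binop = Add | Sub | Mul | Div | Mod

fun apply_binop :: "binop \<Rightarrow> nat \<Rightarrow> nat \<Rightarrow> nat" where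
  "apply_binop Add x y = x + y"
| "apply_binop Sub x y = x - y"
| "apply_binop Mul x y = x * y"
| "apply_binop Div x y = x div y"
| "apply_binop Mod x y = x mod y"

datatype com =
    Skip
  | Const nat nat            \<comment> \<open>target register, constant\<close>
  | Op nat binop nat nat     \<comment> \<open>target register, operation, operand registers\<close>
  | Flip nat                 \<comment> \<open>store a fresh random bit\<close>
  | Seq com com
  | If nat com com           \<comment> \<open>test whether the register is nonzero\<close>
  | While nat com

type_synonym store = "nat \<Rightarrow> nat"

text \<open>
  The second component of a configuration is the string of random bits still to be drawn. A
  drawn bit is lost unless the program keeps it in its registers, where it is charged.
\<close>

type_synonym config = "store \<times> bool list"

text \<open>
  Every one of the \<open>k\<close> available registers is charged at least one bit: otherwise information
  could be hidden for free in the choice of which registers are nonzero.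
\<close>

definition fits :: "nat \<Rightarrow> nat \<Rightarrow> store \<Rightarrow> bool" where
  "fits k s \<sigma> \<longleftrightarrow> (\<forall>r\<ge>k. \<sigma> r = 0) \<and> (\<Sum>r<k. max 1 (floorlog 2 (\<sigma> r))) \<le> s"

text \<open>
  \<open>exec k s c \<kappa> \<kappa>'\<close>: the command \<open>c\<close> terminates from \<open>\<kappa>\<close> in \<open>\<kappa>'\<close>, and every store written on the
  way fits into \<open>k\<close> registers with at most \<open>s\<close> bits in total. The relation is deterministic. A
  command that flips a coin when no random bits are left has no execution.
\<close>

inductive exec :: "nat \<Rightarrow> nat \<Rightarrow> com \<Rightarrow> config \<Rightarrow> config \<Rightarrow> bool" for k s where
  Skip: "exec k s Skip \<kappa> \<kappa>"
| Const: "fits k s (\<sigma>(r := v)) \<Longrightarrow> exec k s (Const r v) (\<sigma>, \<omega>) (\<sigma>(r := v), \<omega>)"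
| Op: "v = apply_binop f (\<sigma> x) (\<sigma> y) \<Longrightarrow> fits k s (\<sigma>(r := v)) \<Longrightarrow>
       exec k s (Op r f x y) (\<sigma>, \<omega>) (\<sigma>(r := v), \<omega>)"
| Flip: "fits k s (\<sigma>(r := of_bool b)) \<Longrightarrow>
         exec k s (Flip r) (\<sigma>, b # \<omega>) (\<sigma>(r := of_bool b), \<omega>)"
| Seq: "exec k s c\<^sub>1 \<kappa> \<kappa>' \<Longrightarrow> exec k s c\<^sub>2 \<kappa>' \<kappa>'' \<Longrightarrow> exec k s (Seq c\<^sub>1 c\<^sub>2) \<kappa> \<kappa>''"
| If_true: "\<sigma> r \<noteq> 0 \<Longrightarrow> exec k s c\<^sub>1 (\<sigma>, \<omega>) \<kappa> \<Longrightarrow> exec k s (If r c\<^sub>1 c\<^sub>2) (\<sigma>, \<omega>) \<kappa>"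
| If_false: "\<sigma> r = 0 \<Longrightarrow> exec k s c\<^sub>2 (\<sigma>, \<omega>) \<kappa> \<Longrightarrow> exec k s (If r c\<^sub>1 c\<^sub>2) (\<sigma>, \<omega>) \<kappa>"
| While_false: "\<sigma> r = 0 \<Longrightarrow> exec k s (While r c) (\<sigma>, \<omega>) (\<sigma>, \<omega>)"
| While_true: "\<sigma> r \<noteq> 0 \<Longrightarrow> exec k s c (\<sigma>, \<omega>) \<kappa> \<Longrightarrow> exec k s (While r c) \<kappa> \<kappa>' \<Longrightarrow>
               exec k s (While r c) (\<sigma>, \<omega>) \<kappa>'"

text \<open>
  \<open>init\<close> is run once before the first pass, \<open>on_letter a\<close> whenever the letter \<open>a\<close> is read, and
  \<open>end_pass\<close> at the end of every pass. The alphabet being finite, \<open>on_letter\<close> is a finite case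
  distinction. The index of the pass and the position in the input are not supplied; an
  algorithm that needs them has to count in its registers.
\<close>

record 'a stream_alg =
  num_regs :: nat
  init :: com
  on_letter :: "'a \<Rightarrow> com"
  end_pass :: com

fun read_letters :: "nat \<Rightarrow> 'a stream_alg \<Rightarrow> 'a list \<Rightarrow> config \<Rightarrow> config \<Rightarrow> bool" where
  "read_letters s M [] \<kappa> \<kappa>' \<longleftrightarrow> \<kappa>' = \<kappa>"
| "read_letters s M (a # x) \<kappa> \<kappa>' \<longleftrightarrow>
     (\<exists>\<kappa>\<^sub>1. exec (num_regs M) s (on_letter M a) \<kappa> \<kappa>\<^sub>1 \<and> read_letters s M x \<kappa>\<^sub>1 \<kappa>')"

fun passes :: "nat \<Rightarrow> nat \<Rightarrow> 'a stream_alg \<Rightarrow> 'a list \<Rightarrow> config \<Rightarrow> config \<Rightarrow> bool" where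
  "passes 0 s M x \<kappa> \<kappa>' \<longleftrightarrow> \<kappa>' = \<kappa>"
| "passes (Suc p) s M x \<kappa> \<kappa>' \<longleftrightarrow>
     (\<exists>\<kappa>\<^sub>1 \<kappa>\<^sub>2. read_letters s M x \<kappa> \<kappa>\<^sub>1 \<and> exec (num_regs M) s (end_pass M) \<kappa>\<^sub>1 \<kappa>\<^sub>2 \<and>
              passes p s M x \<kappa>\<^sub>2 \<kappa>')"

text \<open>
  Register 0 initially contains the input length. Register 1 contains the verdict at the end.
\<close>

definition initial_store :: "nat \<Rightarrow> store" where
  "initial_store n = (\<lambda>_. 0)(0 := n)"

definition run :: "nat \<Rightarrow> nat \<Rightarrow> 'a stream_alg \<Rightarrow> 'a list \<Rightarrow> bool list \<Rightarrow> config \<Rightarrow> bool" where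
  "run p s M x \<omega> \<kappa> \<longleftrightarrow>
     fits (num_regs M) s (initial_store (length x)) \<and>
     (\<exists>\<kappa>\<^sub>0. exec (num_regs M) s (init M) (initial_store (length x), \<omega>) \<kappa>\<^sub>0 \<and>
           passes p s M x \<kappa>\<^sub>0 \<kappa>)"

definition accepts :: "nat \<Rightarrow> 'a stream_alg \<Rightarrow> 'a list \<Rightarrow> bool list \<Rightarrow> bool" where
  "accepts p M x \<omega> \<longleftrightarrow> (\<exists>s \<sigma> \<omega>'. run p s M x \<omega> (\<sigma>, \<omega>') \<and> \<sigma> 1 \<noteq> 0)"

definition rejects :: "nat \<Rightarrow> 'a stream_alg \<Rightarrow> 'a list \<Rightarrow> bool list \<Rightarrow> bool" where
  "rejects p M x \<omega> \<longleftrightarrow> (\<exists>s \<sigma> \<omega>'. run p s M x \<omega> (\<sigma>, \<omega>') \<and> \<sigma> 1 = 0)"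

text \<open>
  On inputs of length \<open>n\<close> over \<open>A\<close>, the \<open>p\<close>-pass algorithm \<open>M\<close> always terminates, uses at most
  \<open>s n\<close> bits of memory, and draws at most \<open>b n\<close> random bits.
\<close>

definition streaming_alg ::
    "'a set \<Rightarrow> nat \<Rightarrow> 'a stream_alg \<Rightarrow> (nat \<Rightarrow> nat) \<Rightarrow> (nat \<Rightarrow> nat) \<Rightarrow> bool" where
  "streaming_alg A p M s b \<longleftrightarrow>
     (\<forall>x \<in> lists A. \<forall>\<omega>. length \<omega> = b (length x) \<longrightarrow> (\<exists>\<kappa>. run p (s (length x)) M x \<omega> \<kappa>))"

definition deterministic_streaming_alg ::
    "'a set \<Rightarrow> nat \<Rightarrow> 'a stream_alg \<Rightarrow> (nat \<Rightarrow> nat) \<Rightarrow> bool" where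
  "deterministic_streaming_alg A p M s \<longleftrightarrow> streaming_alg A p M s (\<lambda>_. 0)"

definition random_bits :: "nat \<Rightarrow> bool list pmf" where
  "random_bits m = pmf_of_set {\<omega>. length \<omega> = m}"

end

theory Submission
  imports Defs "HOL-Computational_Algebra.Computational_Algebra"
begin

text \<open>
  Every step of a derivation produces one more letter at the front and fixes letters at known
  positions at the end. As the input length is known, the lengths decide when the derivation
  stops, so one pass determines it and only equality of the predicted suffix with the actual one
  remains to be tested.

  In the randomized algorithm both suffixes are evaluated as polynomials at a random point modulo
  a prime \<open>q\<close>. There are at least \<open>n\<^sup>2\<close> points to choose from and at most \<open>n\<close> collisions. The prime is
  found by trial division; that one of polynomial size exists follows from the lower bound
  \<open>4\<^sup>m \<le> 2 * Lcm {1..2 * m}\<close>. In the deterministic algorithm with \<open>p\<close> passes the same program compares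
  one block of about \<open>n / p\<close> positions per pass, exactly, by reading the block as a number in a base
  larger than all letter codes.
\<close>

section \<open>Primes of polynomial size\<close>

text \<open>The stack can have linear length, so it cannot be stored. Its letters arrive from the
  last position downwards, those of the input in increasing order. A sum with one contribution
  \<open>c a * r ^ i\<close> per position is indifferent to this order, and every pushed letter
  knows its position at once, because the stack is anchored at the end of the input. So one number
  for each suffix replaces the words. The suffixes depend on the input only, not on the point
  \<open>r\<close>.

  The point consists of t fair bits, where 2^t is at least n^2 + K, and the modulus is the next
  prime above 2^t. Hence the point is uniform after exactly t flips, without repeated sampling, and
  different points are different residues. Only the logarithm of the prime enters the space, so a
  crude bound on the next prime suffices, and the time spent on trial division is not charged.

  In the deterministic algorithm the counters need about log n bits whatever p is; this is why the
  bound n / p is claimed for p log n \<le> n.\<close>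

lemma Lcm_divide_binomial_Ints:
  fixes n k :: nat
  assumes "1 \<le> k" "k \<le> n"
  shows "real (Lcm {1..n}) / real (k * (n choose k)) \<in> \<int>"
  using assms
proof (induction n arbitrary: k)
  case 0
  then show ?case by simp
next
  case (Suc n)
  have Lcm_Suc: "\<exists>c. Lcm {1..Suc n} = c * Lcm {1..n}"
    by (metis Lcm_insert atLeastAtMostSuc_conv dvd_def dvd_lcm2 le_add1 mult.commute plus_1_eq_Suc)
  then obtain c where c: "Lcm {1..Suc n} = c * Lcm {1..n}" by blast
  from Suc.prems show ?case
  proof (induction k rule: nat_induct_at_least)
    case base
    have "Suc n dvd Lcm {1..Suc n}" by (rule dvd_Lcm) auto
    then obtain d where "Lcm {1..Suc n} = Suc n * d" by (elim dvdE)
    then have "real (Lcm {1..Suc n}) / real (1 * (Suc n choose 1)) = real d"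
      unfolding of_nat_mult by (simp only: binomial_1 of_nat_mult) (simp del: of_nat_Suc)
    then show ?case by (metis Ints_of_nat)
  next
    case (Suc k)
    have k: "1 \<le> k" "k \<le> n" using Suc by auto
    have 1: "real (Lcm {1..Suc n}) / real (k * (n choose k)) \<in> \<int>"
      unfolding c using Suc.IH[OF] \<open>\<And>k. 1 \<le> k \<Longrightarrow> k \<le> n \<Longrightarrow> real (Lcm {1..n}) / real (k * (n choose k)) \<in> \<int>\<close>[OF k]
      by (metis Ints_mult Ints_of_nat of_nat_mult times_divide_eq_right)
    have 2: "real (Lcm {1..Suc n}) / real (k * (Suc n choose k)) \<in> \<int>"
      using Suc by simp
    have a: "real (Suc k) * real (Suc n choose Suc k) = real (Suc n) * real (n choose k)"
      using Suc_times_binomial_eq[of n k] by (metis mult.commute of_nat_mult)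
    have b: "(real (Suc n) - real k) * real (Suc n choose k) = real (Suc n) * real (n choose k)"
      using binomial_absorb_comp[of "Suc n" k] k
      by (metis Suc_leD diff_Suc_1 le_SucI of_nat_diff of_nat_mult)
    have pos: "real (n choose k) > 0" "real (Suc n) - real k > 0" "real k > 0" using k by auto
    have bd: "real (Suc n choose k) = real (Suc n) * real (n choose k) / (real (Suc n) - real k)"
      using b pos by (simp add: field_simps del: of_nat_Suc binomial_Suc_Suc)
    \<comment> \<open>The rule of Leibniz's harmonic triangle with entries
      \<open>1 / (k * (n choose k))\<close>: an entry is the difference of one in the row above and
      one in its own row. Multiplied by the lcm both are integers by induction; stating divisibility
      as a quotient in \<int> makes this subtraction possible.\<close>
    have "1 / real (Suc k * (Suc n choose Suc k))
        = 1 / real (k * (n choose k)) - 1 / real (k * (Suc n choose k))"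
      unfolding of_nat_mult a bd using pos
      by (simp add: divide_simps del: of_nat_Suc binomial_Suc_Suc)
    then have "real (Lcm {1..Suc n}) / real (Suc k * (Suc n choose Suc k))
        = real (Lcm {1..Suc n}) / real (k * (n choose k)) - real (Lcm {1..Suc n}) / real (k * (Suc n choose k))"
      by (metis (no_types, lifting) mult.right_neutral right_diff_distrib times_divide_eq_right)
    then show ?case using 1 2 by simp
  qed
qed

lemma Lcm_atLeastAtMost_nonzero: "Lcm {1..n::nat} \<noteq> 0"
  by (simp add: Lcm_0_iff)

text \<open>The lcm is a positive multiple of m * C(2m, m), and the central binomial coefficient is
  at least 4^m / (2m).\<close>

lemma four_power_le_Lcm:
  assumes "0 < m"
  shows "4 ^ m \<le> 2 * Lcm {1..2 * m :: nat}"
proof -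
  have "real (Lcm {1..2*m}) / real (m * (2 * m choose m)) \<in> \<int>"
    using assms by (intro Lcm_divide_binomial_Ints) auto
  moreover have "real (Lcm {1..2*m}) / real (m * (2 * m choose m)) > 0"
    using assms Lcm_atLeastAtMost_nonzero[of "2*m"]
    by (intro divide_pos_pos) (auto simp: zero_less_binomial_iff intro!: Nat.gr0I)
  ultimately have "1 \<le> real (Lcm {1..2*m}) / real (m * (2 * m choose m))"
    by (metis Ints_cases of_int_0_less_iff of_int_1_le_iff int_one_le_iff_zero_less)
  moreover have "0 < real (m * (2 * m choose m))" using assms by simp
  ultimately have "real (m * (2 * m choose m)) \<le> real (Lcm {1..2*m})"
    by (simp add: le_divide_eq del: of_nat_mult)
  moreover have "4 ^ m \<le> 2 * real (m * (2 * m choose m))"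
    using central_binomial_lower_bound[OF assms] assms by (simp add: field_simps)
  ultimately have "real (4 ^ m) \<le> real (2 * Lcm {1..2 * m})" by simp
  then show ?thesis using of_nat_le_iff by blast
qed

text \<open>The multiplicity of a prime in an lcm is the maximum over the arguments, so a single
  argument carries the whole power.\<close>

lemma prime_power_dvd_Lcm:
  fixes p :: nat
  assumes "prime p" "0 < e" "p ^ e dvd Lcm {1..n}"
  shows "\<exists>i\<in>{1..n}. p ^ e dvd i"
  using assms(3)
proof (induction n)
  case 0
  then show ?case using assms prime_gt_1_nat[of p] by simp
next
  case (Suc n)
  have eq: "Lcm {1..Suc n} = lcm (Suc n) (Lcm {1..n})"
    by (simp add: atLeastAtMostSuc_conv)
  have nz: "Suc n \<noteq> 0" "Lcm {1..n} \<noteq> 0" by (simp_all add: Lcm_0_iff)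
  have np: "\<not> is_unit p" using assms(1) by (simp add: prime_nat_iff)
  have "p ^ e dvd Suc n \<or> p ^ e dvd Lcm {1..n}"
    using Suc.prems nz multiplicity_lcm[OF nz assms(1)] np
    unfolding eq by (simp add: power_dvd_iff_le_multiplicity le_max_iff_disj lcm_eq_0_iff)
  then show ?case
  proof
    assume "p ^ e dvd Suc n"
    then show ?thesis by (intro bexI[of _ "Suc n"]) auto
  next
    assume "p ^ e dvd Lcm {1..n}"
    from Suc.IH[OF this] show ?thesis by auto
  qed
qed

text \<open>Each maximal prime power in the lcm divides some number up to \<open>n\<close>, so it is
  at most \<open>n\<close>; there is one such factor per prime.\<close>

lemma Lcm_le_power_card_primes:
  "Lcm {1..n::nat} \<le> n ^ card {p. prime p \<and> p \<le> n}"
proof -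
  let ?L = "Lcm {1..n}"
  have fin: "finite {p. prime p \<and> p \<le> n}" by simp
  have le: "p ^ multiplicity p ?L \<le> n \<and> p \<le> n" if "p \<in> prime_factors ?L" for p
  proof -
    have p: "prime p" "p dvd ?L" using that by (auto simp: prime_factors_dvd)
    have "multiplicity p ?L > 0" using p Lcm_atLeastAtMost_nonzero[of n] that
      by (simp add: prime_factors_multiplicity)
    then obtain i where i: "i \<in> {1..n}" "p ^ multiplicity p ?L dvd i"
      using prime_power_dvd_Lcm[OF p(1) _ multiplicity_dvd] by blast
    obtain j where j: "j \<in> {1..n}" "p dvd j"
      using prime_power_dvd_Lcm[OF p(1), of 1 n] p by auto
    show ?thesis using dvd_imp_le[OF i(2)] dvd_imp_le[OF j(2)] i(1) j(1) by simp
  qed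
  have sub: "prime_factors ?L \<subseteq> {p. prime p \<and> p \<le> n}"
    using le in_prime_factors_imp_prime by blast
  show ?thesis
  proof (cases "n = 0")
    case False
    have "?L = (\<Prod>p\<in>prime_factors ?L. p ^ multiplicity p ?L)"
      by (simp only: prod_prime_factors[OF Lcm_atLeastAtMost_nonzero] normalize_nat_def id_apply)
    also have "\<dots> \<le> (\<Prod>p\<in>prime_factors ?L. n)" using le by (intro prod_mono conjI) blast+
    also have "\<dots> = n ^ card (prime_factors ?L)" by (rule prod_constant)
    also have "\<dots> \<le> n ^ card {p. prime p \<and> p \<le> n}"
      using False card_mono[OF fin sub] by (simp add: power_increasing)
    finally show ?thesis .
  next
    case True
    then have none: "{p. prime p \<and> p \<le> n} = {}" by auto
    show ?thesis unfolding none using True by simp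
  qed
qed

text \<open>Otherwise there are fewer than N primes up to 2 N^2, so the lcm of the numbers up to 2
  N^2 is at most (2 N^2)^N, but it is at least 4^(N^2) / 2. The factor 2 is absorbed into 2^N, so
  that N-th roots can be taken: 4^N \<le> 4 N^2, that is 2^N \<le> 2 N, which fails from N = 3
  on.\<close>

lemma prime_between_square:
  fixes N :: nat
  assumes "3 \<le> N"
  shows "\<exists>p. prime p \<and> N \<le> p \<and> p \<le> 2 * N\<^sup>2"
proof (rule ccontr)
  assume contra: "\<not> ?thesis"
  let ?m = "N\<^sup>2"
  have "{p. prime p \<and> p \<le> 2 * ?m} \<subseteq> {1..<N}"
  proof
    fix p assume "p \<in> {p. prime p \<and> p \<le> 2 * ?m}"
    then show "p \<in> {1..<N}" using contra prime_gt_0_nat[of p] by (auto simp: not_le)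
  qed
  then have "card {p. prime p \<and> p \<le> 2 * ?m} \<le> N"
    by (metis card_atLeastLessThan card_mono diff_le_self finite_atLeastLessThan le_trans)
  then have "Lcm {1..2 * ?m} \<le> (2 * ?m) ^ N"
    using Lcm_le_power_card_primes[of "2 * ?m"] assms
    by (elim order.trans) (intro power_increasing, auto simp: Suc_le_eq)
  then have "4 ^ ?m \<le> 2 * (2 * ?m) ^ N"
    using four_power_le_Lcm[of ?m] assms by simp
  also have "\<dots> \<le> 2 ^ N * (2 * ?m) ^ N"
    using assms by (intro mult_right_mono self_le_power) auto
  also have "\<dots> = (2 * (2 * N\<^sup>2)) ^ N" by (rule power_mult_distrib[symmetric])
  also have "2 * (2 * N\<^sup>2) = 4 * N\<^sup>2" by simp
  also have "(4::nat) ^ ?m = (4 ^ N) ^ N" by (simp only: power_mult power2_eq_square)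
  finally have "(4 ^ N) ^ N \<le> (4 * N\<^sup>2) ^ N" .
  then have "4 ^ N \<le> 4 * N\<^sup>2"
    using assms by (subst (asm) power_mono_iff) auto
  moreover have "(4::nat) ^ N = (2 ^ N)\<^sup>2" by (simp add: power2_eq_square flip: power_mult_distrib)
  ultimately have "(2 ^ N)\<^sup>2 \<le> (2 * N)\<^sup>2" by (simp add: power_mult_distrib)
  then have le: "2 ^ N \<le> 2 * N" by (rule power2_le_imp_le) simp
  have less: "2 * k < 2 ^ k" if "3 \<le> k" for k :: nat
    using that by (induction k rule: nat_induct_at_least) auto
  show False using less[OF assms] le by simp
qed

section \<open>Roots of integer polynomials modulo a prime\<close>

text \<open>Lagrange's bound over the field with \<open>q\<close> elements, expressed in integer
  polynomials: a coefficient not divisible by \<open>q\<close> means that \<open>f\<close> is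
  nonzero modulo \<open>q\<close>. The induction splits off X - a for a root a; the quotient is
  again nonzero modulo \<open>q\<close>, since otherwise \<open>f\<close> would vanish too.\<close>

lemma card_roots_mod_prime:
  fixes f :: "int poly" and q :: int
  assumes "prime q" and "\<not> q dvd coeff f i"
  shows "card {x \<in> {0..<q}. q dvd poly f x} \<le> degree f"
  using assms(2)
proof (induction "degree f" arbitrary: f i)
  case 0
  then obtain c where "f = [:c:]" by (metis degree_eq_zeroE)
  moreover have "\<not> q dvd c" using 0 calculation by (cases i) auto
  ultimately show ?case by simp
next
  case (Suc d)
  show ?case
  proof (cases "{x \<in> {0..<q}. q dvd poly f x} = {}")
    case True
    show ?thesis unfolding True by simp
  next
    case False
    then obtain a where a: "a \<in> {0..<q}" "q dvd poly f a" by auto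
    let ?g = "synthetic_div f a"
    have f: "f = [:-a, 1:] * ?g + [:poly f a:]" by (rule synthetic_div_correct'[symmetric])
    have deg: "degree ?g = d" using Suc.hyps(2) by (simp add: degree_synthetic_div)
    have "\<exists>j. \<not> q dvd coeff ?g j"
    proof (rule ccontr)
      assume "\<not> ?thesis"
      then have all: "q dvd coeff ?g j" for j by blast
      have "q dvd coeff ([:-a, 1:] * ?g + [:poly f a:]) i"
        using all a by (auto simp: coeff_pCons split: nat.splits)
      then show False using Suc.prems f by metis
    qed
    then obtain j where "\<not> q dvd coeff ?g j" by blast
    then have IH: "card {x \<in> {0..<q}. q dvd poly ?g x} \<le> d"
      using Suc.hyps(1)[of ?g] deg by simp
    have "x \<in> insert a {x \<in> {0..<q}. q dvd poly ?g x}" if x: "x \<in> {0..<q}" "q dvd poly f x" for x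
    proof -
      have "poly f x = (x - a) * poly ?g x + poly f a"
        by (subst f) (simp add: algebra_simps)
      then have "q dvd (x - a) * poly ?g x" using x a
        by (metis dvd_add_left_iff)
      then have "q dvd x - a \<or> q dvd poly ?g x" using assms(1) prime_dvd_mult_iff by blast
      moreover have "x = a" if "q dvd x - a"
      proof -
        have "\<bar>x - a\<bar> < q" using x a by auto
        then show ?thesis using dvd_imp_le_int[OF _ that] by (smt (verit))
      qed
      ultimately show ?thesis using x by auto
    qed
    then have "{x \<in> {0..<q}. q dvd poly f x} \<subseteq> insert a {x \<in> {0..<q}. q dvd poly ?g x}" by blast
    then have "card {x \<in> {0..<q}. q dvd poly f x} \<le> card (insert a {x \<in> {0..<q}. q dvd poly ?g x})"
      by (intro card_mono) (auto intro: finite_subset[of _ "{0..<q}"])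
    also have "\<dots> \<le> Suc d" using IH card_insert_le_m1[of "Suc d" _ a] by simp
    finally show ?thesis using Suc.hyps by simp
  qed
qed

section \<open>Deterministic linear automata\<close>

type_synonym 'a trans = "nat \<times> 'a \<times> nat \<times> 'a list"

inductive gen :: "'a trans set \<Rightarrow> nat set \<Rightarrow> nat \<Rightarrow> 'a list \<Rightarrow> bool" for T F where
  gen_Nil: "q \<in> F \<Longrightarrow> gen T F q []"
| gen_Cons: "(q, a, q', u) \<in> T \<Longrightarrow> gen T F q' v \<Longrightarrow> gen T F q (a # v @ u)"

inductive_simps gen_Nil_iff: "gen T F q []"
inductive_cases gen_ConsE: "gen T F q (a # v)"

definition deterministic :: "'a trans set \<Rightarrow> bool" where
  "deterministic T \<longleftrightarrow> (\<forall>q a q' u q'' u'. (q, a, q', u) \<in> T \<longrightarrow> (q, a, q'', u') \<in> T \<longrightarrow> q' = q'' \<and> u = u')"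

text \<open>
  Every transition consumes one letter and pushes a word that has to occur at the end, so the
  letters read and the stack height together reach the input length at one moment at most.
  Therefore the choice between \<open>A \<rightarrow> \<epsilon>\<close> and \<open>A \<rightarrow> a\<omega>\<close> is forced by the lengths. The result of
  \<open>scan\<close> is the rest of the input with the stack it has to be equal to.
\<close>

fun scan :: "'a trans set \<Rightarrow> nat set \<Rightarrow> nat \<Rightarrow> 'a list \<Rightarrow> 'a list \<Rightarrow> ('a list \<times> 'a list) option" where
  "scan T F q [] w = (if w = [] \<and> q \<in> F then Some ([], []) else None)"
| "scan T F q (a # x) w =
     (if Suc (length x) = length w then (if q \<in> F then Some (a # x, w) else None)
      else if Suc (length x) < length w then None
      else if \<exists>q' u. (q, a, q', u) \<in> T
        then let (q', u) = (SOME (q', u). (q, a, q', u) \<in> T) in scan T F q' x (u @ w)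
      else None)"

declare scan.simps(2) [simp del]

lemma scan_trans:
  assumes "deterministic T" "(q, a, q', u) \<in> T" "length w < Suc (length x)"
  shows "scan T F q (a # x) w = scan T F q' x (u @ w)"
proof -
  have "(SOME (q', u). (q, a, q', u) \<in> T) = (q', u)"
    using assms(1,2) unfolding deterministic_def by (intro some_equality) auto
  with assms show ?thesis by (auto simp: scan.simps(2))
qed

lemma scan_no_trans:
  assumes "\<And>q' u. (q, a, q', u) \<notin> T" "length w < Suc (length x)"
  shows "scan T F q (a # x) w = None"
  using assms by (simp add: scan.simps(2))

lemma scan_eq_length:
  assumes "length w = length x"
  shows "scan T F q x w = (if q \<in> F then Some (x, w) else None)"
  using assms by (cases x) (auto simp: scan.simps(2))

lemma scan_less_length: "length x < length w \<Longrightarrow> scan T F q x w = None"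
  by (cases x) (auto simp: scan.simps(2))

text \<open>The stack \<open>w\<close> is generalized for the induction. A word \<open>v\<close>
  with \<open>x = v @ w\<close> has length |x| - |w|: if this is 0 only the empty word remains, and
  if it is positive \<open>v\<close> starts with the unique transition for the next letter. Its word
  \<open>u\<close> goes in front of \<open>w\<close>, because later productions write further
  inside.\<close>

lemma gen_iff_scan:
  assumes "deterministic T"
  shows "(\<exists>v. x = v @ w \<and> gen T F q v) \<longleftrightarrow> (\<exists>y. scan T F q x w = Some (y, y))"
proof (induction x arbitrary: q w)
  case Nil
  then show ?case by (auto simp: gen_Nil_iff)
next
  case (Cons a x)
  consider "length w = Suc (length x)" | "length w > Suc (length x)" | "length w < Suc (length x)"
    by linarith
  then show ?case
  proof cases
    case 1
    then have "a # x = v @ w \<longleftrightarrow> v = [] \<and> w = a # x" for v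
      by (metis append_Nil append_eq_append_conv length_Cons)
    then show ?thesis using 1 by (auto simp: scan_eq_length gen_Nil_iff)
  next
    case 2
    then have "a # x \<noteq> v @ w" for v
      by (metis le_add2 length_Cons length_append not_le)
    then show ?thesis using 2 by (auto simp: scan_less_length)
  next
    case 3
    have nonempty: "\<exists>v'. v = a # v' \<and> x = v' @ w" if "a # x = v @ w" for v
      using that 3 by (cases v) auto
    show ?thesis
    proof (cases "\<exists>q' u. (q, a, q', u) \<in> T")
      case True
      then obtain q' u where t: "(q, a, q', u) \<in> T" by blast
      have "(\<exists>v. a # x = v @ w \<and> gen T F q v) \<longleftrightarrow> (\<exists>v. x = v @ (u @ w) \<and> gen T F q' v)"
      proof
        assume "\<exists>v. a # x = v @ w \<and> gen T F q v"
        then obtain v where v: "x = v @ w" "gen T F q (a # v)" using nonempty by blast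
        from v(2) obtain q'' u' v' where "(q, a, q'', u') \<in> T" "gen T F q'' v'" "v = v' @ u'"
          by (auto elim: gen_ConsE)
        moreover from this t assms have "q'' = q'" "u' = u" by (auto simp: deterministic_def)
        ultimately show "\<exists>v. x = v @ (u @ w) \<and> gen T F q' v" using v by auto
      next
        assume "\<exists>v. x = v @ (u @ w) \<and> gen T F q' v"
        then show "\<exists>v. a # x = v @ w \<and> gen T F q v"
          using gen_Cons[OF t] by (metis append_Cons append_assoc)
      qed
      then show ?thesis unfolding Cons.IH scan_trans[OF assms t 3] .
    next
      case False
      then have "\<not> gen T F q (a # v)" for v by (auto elim: gen_ConsE)
      then show ?thesis using nonempty scan_no_trans[OF _ 3] False by fastforce
    qed
  qed
qed

section \<open>From grammars to automata\<close>

text \<open>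
  Nonterminal \<open>A\<close> becomes state \<open>A + 3\<close>. State 2 stands for the end of the derivation after a
  production without nonterminal; 0 and 1 are left for the phases of the streaming algorithm.
\<close>

definition grammar_trans :: "('a, nat) cfg \<Rightarrow> 'a trans set" where
  "grammar_trans G = {(q, a, q', u). 3 \<le> q \<and> 2 \<le> q' \<and>
     (q - 3, Tm a # (if q' = 2 then [] else [Nt (q' - 3)]) @ map Tm u) \<in> prods G}"

definition grammar_final :: "('a, nat) cfg \<Rightarrow> nat set" where
  "grammar_final G = insert 2 ((\<lambda>A. A + 3) ` {A. (A, []) \<in> prods G})"

section \<open>Derivations and runs of the automaton\<close>

lemma derives_context:
  "(derives1 G)\<^sup>*\<^sup>* \<alpha> \<beta> \<Longrightarrow> (derives1 G)\<^sup>*\<^sup>* (l @ \<alpha> @ r) (l @ \<beta> @ r)"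
proof (induction rule: rtranclp_induct)
  case (step y z)
  have "derives1 G (l @ y @ r) (l @ z @ r)"
    using step.hyps(2)
  proof cases
    case (1 A w u v)
    then show ?thesis using derives1.intros[of A w G "l @ u" "v @ r"] by simp
  qed
  with step.IH show ?case by (rule rtranclp.rtrancl_into_rtrancl)
qed simp

text \<open>The second conjunct serves productions without nonterminal: no transition leaves state
  2, so it generates the empty word only.\<close>

lemma gen_imp_derives:
  assumes "gen (grammar_trans G) (grammar_final G) q v"
  shows "(3 \<le> q \<longrightarrow> (derives1 G)\<^sup>*\<^sup>* [Nt (q - 3)] (map Tm v)) \<and> (q = 2 \<longrightarrow> v = [])"
  using assms
proof induction
  case (gen_Nil q)
  then have "(q - 3, []) \<in> prods G" if "3 \<le> q"
    using that by (auto simp: grammar_final_def)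
  then have "derives1 G [Nt (q - 3)] []" if "3 \<le> q"
    using derives1.intros[of "q - 3" "[]" G "[]" "[]"] that by simp
  then show ?case by auto
next
  case (gen_Cons q a q' u v)
  have q: "3 \<le> q" "2 \<le> q'" "(q - 3, Tm a # (if q' = 2 then [] else [Nt (q' - 3)]) @ map Tm u) \<in> prods G"
    using gen_Cons.hyps by (auto simp: grammar_trans_def)
  have 1: "derives1 G [Nt (q - 3)] (Tm a # (if q' = 2 then [] else [Nt (q' - 3)]) @ map Tm u)"
    using derives1.intros[OF q(3), of "[]" "[]"] by simp
  have "(derives1 G)\<^sup>*\<^sup>* [Nt (q - 3)] (map Tm (a # v @ u))"
  proof (cases "q' = 2")
    case True
    then show ?thesis using 1 gen_Cons.IH by auto
  next
    case False
    then have "(derives1 G)\<^sup>*\<^sup>* [Nt (q' - 3)] (map Tm v)" using gen_Cons.IH q by auto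
    from derives_context[OF this, of "[Tm a]" "map Tm u"] 1 False
    show ?thesis by (simp add: converse_rtranclp_into_rtranclp)
  qed
  then show ?case using q by simp
qed

lemma map_Tm_eq_iff: "map Tm u = map Tm u' \<longleftrightarrow> u = u'"
  by (rule inj_map_eq_map) (simp add: inj_def)

text \<open>In a sentential form with one nonterminal there is only one place where a production can
  apply.\<close>

lemma append_Nt_eq_map_Tm:
  "l @ Nt B # r = map Tm y @ Nt A # map Tm z \<longleftrightarrow> l = map Tm y \<and> B = A \<and> r = map Tm z"
proof (induction y arbitrary: l)
  case Nil
  show ?case by (cases l) (auto simp: append_eq_map_conv)
next
  case (Cons b y)
  then show ?case by (cases l) auto
qed

text \<open>Sentential forms of a linear grammar contain at most one nonterminal, and the two
  conjuncts cover one and none. The induction strips the first derivation step, which is the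
  outermost transition; a form without nonterminal admits no step.\<close>

lemma derives_imp_gen:
  assumes "is_dl_cfg G" "(derives1 G)\<^sup>*\<^sup>* s (map Tm x)"
  shows "(\<forall>y A z. s = map Tm y @ Nt A # map Tm z \<longrightarrow>
            (\<exists>v. x = y @ v @ z \<and> gen (grammar_trans G) (grammar_final G) (A + 3) v)) \<and>
         (\<forall>y. s = map Tm y \<longrightarrow> x = y)"
  using assms(2)
proof (induction rule: converse_rtranclp_induct)
  case base
  show ?case by (auto simp: map_Tm_eq_iff map_eq_append_conv Cons_eq_map_conv map_eq_Cons_conv)
next
  case (step s t)
  let ?gen = "gen (grammar_trans G) (grammar_final G)"
  from step.hyps(1) obtain B w l r where s: "s = l @ [Nt B] @ r" and t: "t = l @ w @ r"
    and p: "(B, w) \<in> prods G" by cases auto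
  show ?case
  proof (intro conjI allI impI)
    fix y A z assume "s = map Tm y @ Nt A # map Tm z"
    then have [simp]: "l = map Tm y" "A = B" "r = map Tm z"
      using s append_Nt_eq_map_Tm[of l B r y A z] by auto
    consider (empty) "w = []" | (lin) a u where "w = Tm a # map Tm u"
      | (nonterm) a C u where "w = Tm a # Nt C # map Tm u"
      using assms(1) p unfolding is_dl_cfg_def by blast
    then show "\<exists>v. x = y @ v @ z \<and> ?gen (A + 3) v"
    proof cases
      case empty
      then have "t = map Tm (y @ z)" using t by simp
      then have "x = y @ [] @ z" using step.IH by blast
      moreover have "?gen (A + 3) []" using p empty by (auto intro!: gen_Nil simp: grammar_final_def)
      ultimately show ?thesis by blast
    next
      case (lin a u)
      then have "t = map Tm (y @ a # u @ z)" using t by simp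
      then have "x = y @ (a # [] @ u) @ z" using step.IH by fastforce
      moreover have "?gen (A + 3) (a # [] @ u)"
        by (rule gen_Cons[of _ _ 2], use p lin in \<open>auto intro!: gen_Nil simp: grammar_final_def grammar_trans_def\<close>)
      ultimately show ?thesis by blast
    next
      case (nonterm a C u)
      then have "t = map Tm (y @ [a]) @ Nt C # map Tm (u @ z)" using t by simp
      then obtain v where v: "x = (y @ [a]) @ v @ (u @ z)" "?gen (C + 3) v" using step.IH by blast
      have "?gen (A + 3) (a # v @ u)"
        by (rule gen_Cons[of _ _ "C + 3"], use p nonterm v in \<open>auto simp: grammar_trans_def\<close>)
      with v show ?thesis by (intro exI[of _ "a # v @ u"]) simp
    qed
  next
    fix y assume "s = map Tm y"
    then show "x = y" using s by (auto simp: append_eq_map_conv map_eq_append_conv)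
  qed
qed

lemma language_iff_gen:
  assumes "is_dl_cfg G"
  shows "x \<in> language G \<longleftrightarrow> gen (grammar_trans G) (grammar_final G) (start G + 3) x"
proof
  assume "x \<in> language G"
  then have "(derives1 G)\<^sup>*\<^sup>* [Nt (start G)] (map Tm x)" by (simp add: language_def)
  from derives_imp_gen[OF assms this, THEN conjunct1, rule_format, of "[]" "start G" "[]"]
  show "gen (grammar_trans G) (grammar_final G) (start G + 3) x" by auto
next
  assume "gen (grammar_trans G) (grammar_final G) (start G + 3) x"
  from gen_imp_derives[OF this] show "x \<in> language G" by (simp add: language_def)
qed

text \<open>The case distinction keeps the encoding injective: with truncated subtraction alone,
  states 2 and 3 would both give nonterminal 0.\<close>

lemma body_eq_iff:
  fixes q' q'' :: nat
  assumes "2 \<le> q'" "2 \<le> q''"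
  shows "(if q' = 2 then [] else [Nt (q' - 3)]) @ map Tm u =
      (if q'' = 2 then [] else [Nt (q'' - 3)]) @ map Tm u' \<longleftrightarrow> q' = q'' \<and> u = u'"
  using assms by (cases "q' = 2"; cases "q'' = 2") (auto simp: map_Tm_eq_iff Cons_eq_map_conv map_eq_Cons_conv)

lemma finite_grammar_trans:
  assumes "is_dl_cfg G"
  shows "finite (grammar_trans G)"
proof -
  let ?f = "\<lambda>(q, a, q', u). (q - 3, Tm a # (if q' = 2 then [] else [Nt (q' - 3)]) @ map Tm u)"
  have "inj_on ?f (grammar_trans G)"
  proof (rule inj_onI)
    fix s t assume *: "s \<in> grammar_trans G" "t \<in> grammar_trans G" "?f s = ?f t"
    obtain q a q' u p b p' v where "s = (q, a, q', u)" "t = (p, b, p', v)"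
      by (cases s; cases t)
    moreover from this have "q - 3 = p - 3" "3 \<le> q" "3 \<le> p" using * by (auto simp: grammar_trans_def)
    ultimately show "s = t" using * body_eq_iff[of q' p' u v] by (simp add: grammar_trans_def)
  qed
  moreover have "?f ` grammar_trans G \<subseteq> prods G" by (auto simp: grammar_trans_def)
  moreover have "finite (prods G)" using assms by (simp add: is_dl_cfg_def is_cfg_def)
  ultimately show ?thesis using finite_imageD finite_subset by blast
qed

lemma finite_grammar_final:
  assumes "is_dl_cfg G"
  shows "finite (grammar_final G)"
proof -
  have "finite (prods G)" using assms by (simp add: is_dl_cfg_def is_cfg_def)
  moreover have "{A. (A, []) \<in> prods G} \<subseteq> fst ` prods G" by force
  ultimately show ?thesis unfolding grammar_final_def by (meson finite_imageI finite_insert finite_subset)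
qed

lemma deterministic_grammar_trans:
  assumes "is_dl_cfg G"
  shows "deterministic (grammar_trans G)"
  unfolding deterministic_def
proof (intro allI impI)
  fix q a q' u q'' u'
  assume *: "(q, a, q', u) \<in> grammar_trans G" "(q, a, q'', u') \<in> grammar_trans G"
  let ?w = "\<lambda>q' u. (if q' = 2 then [] else [Nt (q' - 3)]) @ map Tm u"
  have p: "(q - 3, Tm a # ?w q' u) \<in> prods G" "(q - 3, Tm a # ?w q'' u') \<in> prods G"
    using * by (auto simp: grammar_trans_def)
  \<comment> \<open>Different bodies for the same nonterminal would have different first
    letters.\<close>
  have "Tm a # ?w q' u = Tm a # ?w q'' u'"
    using assms p unfolding is_dl_cfg_def by blast
  then show "q' = q'' \<and> u = u'"
    using * body_eq_iff[of q' q'' u u'] by (simp add: grammar_trans_def)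
qed

lemma grammar_trans_word:
  assumes "is_dl_cfg G" "(q, a, q', u) \<in> grammar_trans G"
  shows "set u \<subseteq> terms G"
proof -
  have "(q - 3, Tm a # (if q' = 2 then [] else [Nt (q' - 3)]) @ map Tm u) \<in> prods G"
    using assms(2) by (auto simp: grammar_trans_def)
  moreover have "prods G \<subseteq> nonterms G \<times> lists (Tm ` terms G \<union> Nt ` nonterms G)"
    using assms(1) by (simp add: is_dl_cfg_def is_cfg_def)
  ultimately have "set (map Tm u) \<subseteq> Tm ` terms G \<union> Nt ` nonterms G"
    by (auto simp: in_lists_conv_set subset_iff dest!: bspec)
  then show ?thesis by auto
qed

section \<open>Fingerprints\<close>

text \<open>The exponent is relative to \<open>lo\<close>, so the size of an exact hash depends on
  the width of the window and not on its place.\<close>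

definition weight :: "nat \<Rightarrow> nat \<Rightarrow> nat \<Rightarrow> nat \<Rightarrow> nat" where
  "weight r lo hi i = (if lo \<le> i \<and> i < hi then r ^ (i - lo) else 0)"

text \<open>The index \<open>i\<close> is the absolute position of the first letter. If
  \<open>r\<close> is a random point, this is the value of a polynomial with the letter codes as
  coefficients; if \<open>r\<close> exceeds all codes, it is a number in base \<open>r\<close>,
  least significant digit first.\<close>

fun hash :: "('a \<Rightarrow> nat) \<Rightarrow> nat \<Rightarrow> nat \<Rightarrow> nat \<Rightarrow> nat \<Rightarrow> 'a list \<Rightarrow> nat" where
  "hash c r lo hi i [] = 0"
| "hash c r lo hi i (a # x) = c a * weight r lo hi i + hash c r lo hi (Suc i) x"

lemma hash_append:
  "hash c r lo hi i (x @ y) = hash c r lo hi i x + hash c r lo hi (i + length x) y"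
  by (induction x arbitrary: i) auto

lemma hash_beyond: "hi \<le> i \<Longrightarrow> hash c r lo hi i x = 0"
  by (induction x arbitrary: i) (auto simp: weight_def)

text \<open>The summand \<open>r ^ (i - lo)\<close> strengthens the bound for the induction. Inside
  the window c a + 1 \<le> r lets it grow to the next power; left of the window truncated
  subtraction keeps it at 1.\<close>

lemma hash_add_le:
  assumes "\<forall>a\<in>set x. c a < r" "i \<le> hi" "0 < r"
  shows "hash c r lo hi i x + r ^ (i - lo) \<le> r ^ (hi - lo)"
  using assms(1,2)
proof (induction x arbitrary: i)
  case Nil
  then show ?case using \<open>0 < r\<close> by (auto intro!: power_increasing)
next
  case (Cons a x)
  consider "i = hi" | "i < hi" "i < lo" | "i < hi" "lo \<le> i" using Cons.prems by linarith
  then show ?case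
  proof cases
    case 1
    then show ?thesis by (simp add: weight_def hash_beyond)
  next
    case 2
    then show ?thesis using Cons.IH[of "Suc i"] Cons.prems by (simp add: weight_def)
  next
    case 3
    have "c a * r ^ (i - lo) + r ^ (i - lo) \<le> r ^ (Suc i - lo)"
      using Cons.prems 3 mult_right_mono[of "Suc (c a)" r "r ^ (i - lo)"] by (simp add: Suc_diff_le)
    then show ?thesis using Cons.IH[of "Suc i"] Cons.prems 3 by (simp add: weight_def)
  qed
qed

lemma hash_less:
  assumes "\<forall>a\<in>set x. c a < r" "0 < r"
  shows "hash c r lo hi i x < r ^ (hi - lo)"
proof (cases "i \<le> hi")
  case True
  have "0 < r ^ (i - lo)" using assms by simp
  then show ?thesis using hash_add_le[OF assms(1) True assms(2), of lo] by linarith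
next
  case False
  then show ?thesis using assms by (simp add: hash_beyond)
qed

text \<open>All weights from position \<open>i\<close> on are multiples of this power, which lets
  the lowest digit be isolated modulo \<open>r\<close>.\<close>

lemma power_dvd_hash: "r ^ (i - lo) dvd hash c r lo hi i x"
proof (induction x arbitrary: i)
  case (Cons a x)
  have "r ^ (i - lo) dvd r ^ (Suc i - lo)" by (intro le_imp_power_dvd) auto
  then show ?case using Cons.IH[of "Suc i"] by (auto simp: weight_def intro: dvd_trans)
qed simp

text \<open>Uniqueness of digits: divide by the weight of the current position and reduce modulo
  \<open>r\<close> to obtain the first letter, then cancel its contribution. Letters left of the
  window contribute nothing and may differ.\<close>

lemma hash_eq_imp_nth_eq:
  assumes "hash c r lo hi i x = hash c r lo hi i y" "length x = length y" "inj_on c A"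
    "set x \<subseteq> A" "set y \<subseteq> A" "\<And>a. a \<in> A \<Longrightarrow> c a < r"
    "j < length x" "lo \<le> i + j" "i + j < hi"
  shows "x ! j = y ! j"
  using assms(1,2,4,5,7-)
proof (induction x arbitrary: i y j)
  case Nil
  then show ?case by simp
next
  case (Cons a x)
  then obtain b y' where y: "y = b # y'" "length x = length y'" by (cases y) auto
  have ab: "a \<in> A" "b \<in> A" using Cons.prems y by auto
  have r: "0 < r" using assms(6)[OF ab(1)] by simp
  have head: "a = b" if "lo \<le> i"
  proof -
    have "i < hi" using Cons.prems by simp
    then have eq: "c a * r ^ (i - lo) + hash c r lo hi (Suc i) x = c b * r ^ (i - lo) + hash c r lo hi (Suc i) y'"
      using Cons.prems y that by (simp add: weight_def)
    obtain s where s: "hash c r lo hi (Suc i) x = r ^ (Suc i - lo) * s" using power_dvd_hash by (rule dvdE)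
    obtain t where t: "hash c r lo hi (Suc i) y' = r ^ (Suc i - lo) * t" using power_dvd_hash by (rule dvdE)
    have "r ^ (i - lo) * (c a + r * s) = r ^ (i - lo) * (c b + r * t)"
      using eq that unfolding s t by (simp add: Suc_diff_le algebra_simps)
    then have "c a + r * s = c b + r * t" using r by simp
    then have "(c a + r * s) mod r = (c b + r * t) mod r" by simp
    then have "c a = c b" using assms(6) ab by simp
    then show ?thesis using assms(3) ab by (simp add: inj_on_def)
  qed
  have tail: "hash c r lo hi (Suc i) x = hash c r lo hi (Suc i) y'"
    using Cons.prems(1) y head by (cases "lo \<le> i") (auto simp: weight_def)
  show ?case
  proof (cases j)
    case 0
    then show ?thesis using head Cons.prems y by simp
  next
    case (Suc k)
    then show ?thesis using Cons.IH[OF tail y(2), of k] Cons.prems y by simp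
  qed
qed

lemma eq_if_hash_windows_eq:
  assumes "\<And>k. k < p \<Longrightarrow> hash c r (k * l) (k * l + l) i x = hash c r (k * l) (k * l + l) i y"
    "length x = length y" "inj_on c A"
    "set x \<subseteq> A" "set y \<subseteq> A" "\<And>a. a \<in> A \<Longrightarrow> c a < r"
    "i + length x \<le> p * l" "0 < l"
  shows "x = y"
proof (rule nth_equalityI)
  fix j assume j: "j < length x"
  \<comment> \<open>The window that contains the absolute position \<open>i + j\<close>.\<close>
  let ?k = "(i + j) div l"
  have "?k < p" using j assms(7,8) by (simp add: less_mult_imp_div_less)
  moreover have "?k * l \<le> i + j" "i + j < ?k * l + l"
    using \<open>0 < l\<close> by (simp_all add: dividend_less_div_times add.commute)
  ultimately show "x ! j = y ! j"
    using hash_eq_imp_nth_eq[OF assms(1) assms(2-6) j] by blast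
qed (rule assms)

section \<open>Collisions of fingerprints modulo a prime\<close>

fun diff_poly :: "('a \<Rightarrow> nat) \<Rightarrow> nat \<Rightarrow> 'a list \<Rightarrow> 'a list \<Rightarrow> int poly" where
  "diff_poly c i (a # x) (b # y) = monom (int (c a) - int (c b)) i + diff_poly c (Suc i) x y"
| "diff_poly c i _ _ = 0"

lemma poly_diff_poly:
  assumes "length x = length y" "i + length x \<le> n"
  shows "poly (diff_poly c i x y) (int r) = int (hash c r 0 n i x) - int (hash c r 0 n i y)"
  using assms
  by (induction c i x y rule: diff_poly.induct) (auto simp: weight_def poly_monom algebra_simps)

lemma coeff_diff_poly_less: "j < i \<Longrightarrow> coeff (diff_poly c i x y) j = 0"
  by (induction c i x y rule: diff_poly.induct) auto

lemma coeff_diff_poly_ge: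
  "i + length x \<le> j \<Longrightarrow> coeff (diff_poly c i x y) j = 0"
  by (induction c i x y rule: diff_poly.induct) auto

text \<open>At a position where the words differ, the coefficient is the difference of two distinct
  codes below \<open>q\<close>; its absolute value lies strictly between 0 and
  \<open>q\<close>.\<close>

lemma coeff_diff_poly_not_dvd:
  assumes "length x = length y" "x \<noteq> y" "inj_on c A" "set x \<subseteq> A" "set y \<subseteq> A"
    "\<And>a. a \<in> A \<Longrightarrow> c a < q"
  shows "\<exists>j. \<not> int q dvd coeff (diff_poly c i x y) j"
  using assms(1,2,4,5)
proof (induction x y arbitrary: i rule: list_induct2)
  case Nil
  then show ?case by simp
next
  case (Cons a x b y)
  show ?case
  proof (cases "a = b")
    case True
    then show ?thesis using Cons by auto
  next
    case False
    then have "c a \<noteq> c b" "c a < q" "c b < q" using assms(3,6) Cons.prems by (auto simp: inj_on_def)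
    then have "\<not> int q dvd \<bar>int (c a) - int (c b)\<bar>" by (intro zdvd_not_zless) auto
    then have "\<not> int q dvd coeff (diff_poly c i (a # x) (b # y)) i"
      by (simp add: coeff_diff_poly_less)
    then show ?thesis by blast
  qed
qed

text \<open>A collision is a root modulo \<open>q\<close> of the difference polynomial, which is
  nonzero modulo \<open>q\<close> and has degree at most \<open>n\<close>.\<close>

lemma card_hash_collisions:
  assumes "prime q" "length x = length y" "x \<noteq> y" "inj_on c A" "set x \<subseteq> A" "set y \<subseteq> A"
    "\<And>a. a \<in> A \<Longrightarrow> c a < q" "i + length x \<le> n"
  shows "card {r. r < q \<and> hash c r 0 n i x mod q = hash c r 0 n i y mod q} \<le> n"
proof -
  let ?f = "diff_poly c i x y" and ?R = "{r. r < q \<and> hash c r 0 n i x mod q = hash c r 0 n i y mod q}"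
  obtain j where j: "\<not> int q dvd coeff ?f j"
    using coeff_diff_poly_not_dvd[OF assms(2-7)] by blast
  have "int ` ?R \<subseteq> {r \<in> {0..<int q}. int q dvd poly ?f r}"
    using assms(2,8) by (auto simp: poly_diff_poly mod_eq_dvd_iff zmod_int[symmetric] simp flip: mod_eq_dvd_iff)
  moreover have "finite {r \<in> {0..<int q}. int q dvd poly ?f r}" by (rule finite_subset[of _ "{0..<int q}"]) auto
  ultimately have "card (int ` ?R) \<le> card {r \<in> {0..<int q}. int q dvd poly ?f r}"
    by (rule card_mono[rotated])
  also have "\<dots> \<le> degree ?f"
    using card_roots_mod_prime[OF _ j] assms(1) by simp
  also have "\<dots> \<le> n"
    by (rule degree_le) (use assms(8) in \<open>auto intro!: coeff_diff_poly_ge\<close>)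
  also have "card (int ` ?R) = card ?R" by (rule card_image) simp
  finally show ?thesis .
qed

section \<open>Program verification\<close>

text \<open>A bound on each of the 17 registers separately can be checked locally at every
  assignment and costs only a constant factor against a bound on the total. The value 1 forces all
  other registers to be 0.\<close>

definition bnd :: "nat \<Rightarrow> store \<Rightarrow> bool" where
  "bnd m \<sigma> \<longleftrightarrow> (\<forall>i. \<sigma> i < (if i < 17 then 2 ^ m else 1))"

text \<open>Total correctness, with \<open>bnd\<close> built in as assumption and guarantee, so that
  invariants need not mention the space.\<close>

definition wp :: "nat \<Rightarrow> com \<Rightarrow> (config \<Rightarrow> bool) \<Rightarrow> config \<Rightarrow> bool" where
  "wp m c Q \<kappa> \<longleftrightarrow> (bnd m (fst \<kappa>) \<longrightarrow>
     (\<exists>\<kappa>'. exec 17 (17 * m) c \<kappa> \<kappa>' \<and> bnd m (fst \<kappa>') \<and> Q \<kappa>'))"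

abbreviation seq (infixr ";;" 60) where "c ;; d \<equiv> Seq c d"

lemma bnd_upd:
  assumes "bnd m \<sigma>" "r < 17" "v < 2 ^ m"
  shows "bnd m (\<sigma>(r := v))"
  unfolding bnd_def
proof
  fix i show "(\<sigma>(r := v)) i < (if i < 17 then 2 ^ m else 1)"
    using assms(1)[unfolded bnd_def, rule_format, of i] assms(2,3) by (cases "i = r") auto
qed

lemma bndD: "bnd m \<sigma> \<Longrightarrow> r < 17 \<Longrightarrow> \<sigma> r < 2 ^ m"
  unfolding bnd_def by (drule spec[of _ r]) simp

lemma bnd_imp_fits:
  assumes "bnd m \<sigma>" "0 < m"
  shows "fits 17 (17 * m) \<sigma>"
proof -
  have "\<sigma> r = 0" if "r \<ge> 17" for r
    using assms(1)[unfolded bnd_def, rule_format, of r] that by simp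
  moreover have "max 1 (floorlog 2 (\<sigma> r)) \<le> m" if "r < 17" for r
    using bndD[OF assms(1) that] assms(2) by (auto intro!: floorlog_leI)
  then have "(\<Sum>r<17. max 1 (floorlog 2 (\<sigma> r))) \<le> (\<Sum>r<17::nat. m)" by (intro sum_mono) auto
  ultimately show ?thesis by (simp add: fits_def)
qed

lemma wp_conseq: "wp m c Q \<kappa> \<Longrightarrow> (\<And>\<kappa>'. Q \<kappa>' \<Longrightarrow> R \<kappa>') \<Longrightarrow> wp m c R \<kappa>"
  unfolding wp_def by blast

lemma wp_bndI: "(bnd m (fst \<kappa>) \<Longrightarrow> wp m c Q \<kappa>) \<Longrightarrow> wp m c Q \<kappa>"
  unfolding wp_def by blast

text \<open>Symbolic execution reaches a known store through different updates; this leaves their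
  equality as an extensional side condition.\<close>

lemma wp_store_eq: "wp m c Q (\<sigma>, \<omega>) \<Longrightarrow> \<sigma>' = \<sigma> \<Longrightarrow> wp m c Q (\<sigma>', \<omega>)"
  by simp

lemma wp_Skip: "Q \<kappa> \<Longrightarrow> wp m Skip Q \<kappa>"
  unfolding wp_def using exec.Skip by blast

lemma wp_Seq: "wp m c (wp m d Q) \<kappa> \<Longrightarrow> wp m (c ;; d) Q \<kappa>"
  unfolding wp_def by (blast intro: exec.Seq)

lemma wp_Const: "r < 17 \<Longrightarrow> 0 < m \<Longrightarrow> v < 2 ^ m \<Longrightarrow> Q (\<sigma>(r := v), \<omega>) \<Longrightarrow> wp m (Const r v) Q (\<sigma>, \<omega>)"
  unfolding wp_def by (auto intro!: exec.Const bnd_imp_fits bnd_upd)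

lemma wp_Op:
  assumes "r < 17" "0 < m" "bnd m \<sigma> \<Longrightarrow> apply_binop f (\<sigma> x) (\<sigma> y) < 2 ^ m"
    "Q (\<sigma>(r := apply_binop f (\<sigma> x) (\<sigma> y)), \<omega>)"
  shows "wp m (Op r f x y) Q (\<sigma>, \<omega>)"
  unfolding wp_def
proof
  let ?\<kappa> = "(\<sigma>(r := apply_binop f (\<sigma> x) (\<sigma> y)), \<omega>)"
  assume "bnd m (fst (\<sigma>, \<omega>))"
  then have "bnd m (fst ?\<kappa>)" using assms(1,3) by (simp add: bnd_upd)
  moreover from this have "exec 17 (17 * m) (Op r f x y) (\<sigma>, \<omega>) ?\<kappa>"
    by (intro exec.Op[OF refl] bnd_imp_fits[OF _ assms(2)]) simp
  ultimately show "\<exists>\<kappa>'. exec 17 (17 * m) (Op r f x y) (\<sigma>, \<omega>) \<kappa>' \<and> bnd m (fst \<kappa>') \<and> Q \<kappa>'"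
    using assms(4) by blast
qed

lemma wp_Add: "r < 17 \<Longrightarrow> 0 < m \<Longrightarrow> \<sigma> x + \<sigma> y < 2 ^ m \<Longrightarrow> Q (\<sigma>(r := \<sigma> x + \<sigma> y), \<omega>) \<Longrightarrow>
    wp m (Op r Add x y) Q (\<sigma>, \<omega>)"
  by (rule wp_Op) auto

lemma wp_Mul: "r < 17 \<Longrightarrow> 0 < m \<Longrightarrow> \<sigma> x * \<sigma> y < 2 ^ m \<Longrightarrow> Q (\<sigma>(r := \<sigma> x * \<sigma> y), \<omega>) \<Longrightarrow>
    wp m (Op r Mul x y) Q (\<sigma>, \<omega>)"
  by (rule wp_Op) auto

text \<open>Subtraction, remainder and division never exceed their first operand, even with second
  operand 0, so unlike sums and products they require no separate size bound.\<close>

lemma wp_Sub: "r < 17 \<Longrightarrow> x < 17 \<Longrightarrow> 0 < m \<Longrightarrow> Q (\<sigma>(r := \<sigma> x - \<sigma> y), \<omega>) \<Longrightarrow>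
    wp m (Op r Sub x y) Q (\<sigma>, \<omega>)"
  by (rule wp_Op) (auto intro: less_imp_diff_less bndD)

lemma wp_Mod: "r < 17 \<Longrightarrow> x < 17 \<Longrightarrow> 0 < m \<Longrightarrow> Q (\<sigma>(r := \<sigma> x mod \<sigma> y), \<omega>) \<Longrightarrow>
    wp m (Op r Mod x y) Q (\<sigma>, \<omega>)"
  by (rule wp_Op) (auto intro: le_less_trans[OF mod_less_eq_dividend] bndD)

lemma wp_Div: "r < 17 \<Longrightarrow> x < 17 \<Longrightarrow> 0 < m \<Longrightarrow> Q (\<sigma>(r := \<sigma> x div \<sigma> y), \<omega>) \<Longrightarrow>
    wp m (Op r Div x y) Q (\<sigma>, \<omega>)"
  by (rule wp_Op) (auto intro: le_less_trans[OF div_le_dividend] bndD)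

lemma wp_Flip:
  assumes "r < 17" "0 < m" "Q (\<sigma>(r := of_bool b), \<omega>)"
  shows "wp m (Flip r) Q (\<sigma>, b # \<omega>)"
  unfolding wp_def
proof
  let ?\<kappa> = "(\<sigma>(r := of_bool b), \<omega>)"
  assume "bnd m (fst (\<sigma>, b # \<omega>))"
  moreover have "of_bool b < (2::nat) ^ m" using one_less_power[of "2::nat" m] assms(2) by (cases b) auto
  ultimately have "bnd m (fst ?\<kappa>)" using assms(1) by (simp add: bnd_upd)
  moreover from this have "exec 17 (17 * m) (Flip r) (\<sigma>, b # \<omega>) ?\<kappa>"
    by (intro exec.Flip bnd_imp_fits[OF _ assms(2)]) simp
  ultimately show "\<exists>\<kappa>'. exec 17 (17 * m) (Flip r) (\<sigma>, b # \<omega>) \<kappa>' \<and> bnd m (fst \<kappa>') \<and> Q \<kappa>'"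
    using assms(3) by blast
qed

lemma wp_If: "(\<sigma> r \<noteq> 0 \<Longrightarrow> wp m c Q (\<sigma>, \<omega>)) \<Longrightarrow> (\<sigma> r = 0 \<Longrightarrow> wp m d Q (\<sigma>, \<omega>)) \<Longrightarrow>
    wp m (If r c d) Q (\<sigma>, \<omega>)"
  unfolding wp_def by (cases "\<sigma> r = 0") (blast intro: exec.If_true exec.If_false)+

lemma wp_While:
  assumes "I \<sigma> \<omega>"
    and "\<And>\<sigma> \<omega>. I \<sigma> \<omega> \<Longrightarrow> \<sigma> r \<noteq> 0 \<Longrightarrow>
      wp m c (\<lambda>(\<sigma>', \<omega>'). I \<sigma>' \<omega>' \<and> \<mu> \<sigma>' < (\<mu> \<sigma> :: nat)) (\<sigma>, \<omega>)"
    and "\<And>\<sigma> \<omega>. I \<sigma> \<omega> \<Longrightarrow> \<sigma> r = 0 \<Longrightarrow> Q (\<sigma>, \<omega>)"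
  shows "wp m (While r c) Q (\<sigma>, \<omega>)"
  using assms(1)
proof (induction "\<mu> \<sigma>" arbitrary: \<sigma> \<omega> rule: less_induct)
  case less
  show ?case
  proof (cases "\<sigma> r = 0")
    case True
    then show ?thesis using assms(3)[OF less.prems] unfolding wp_def by (blast intro: exec.While_false)
  next
    case False
    show ?thesis unfolding wp_def
    proof
      assume b: "bnd m (fst (\<sigma>, \<omega>))"
      then obtain \<sigma>' \<omega>' where 1: "exec 17 (17 * m) c (\<sigma>, \<omega>) (\<sigma>', \<omega>')" "bnd m \<sigma>'" "I \<sigma>' \<omega>'" "\<mu> \<sigma>' < \<mu> \<sigma>"
        using assms(2)[OF less.prems False] unfolding wp_def by auto
      from less.hyps[OF 1(4,3)] 1(2) obtain \<kappa> where
        "exec 17 (17 * m) (While r c) (\<sigma>', \<omega>') \<kappa>" "bnd m (fst \<kappa>)" "Q \<kappa>"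
        unfolding wp_def by auto
      then show "\<exists>\<kappa>'. exec 17 (17 * m) (While r c) (\<sigma>, \<omega>) \<kappa>' \<and> bnd m (fst \<kappa>') \<and> Q \<kappa>'"
        using exec.While_true[OF False 1(1)] by blast
    qed
  qed
qed

section \<open>The streaming algorithm\<close>

text \<open>
  The letters on the stack are those predicted for the positions from \<open>rTop\<close> on. Both hashes
  only see the positions from \<open>rLo\<close> to \<open>rHi\<close>. State 0 means that the input has been rejected,
  state 1 that the stack is being compared with the input. With \<open>rMod\<close> = 0 nothing is reduced,
  as \<open>x mod 0 = x\<close>.
\<close>

abbreviation (input) "rLen \<equiv> 0 :: nat"
abbreviation (input) "rVerdict \<equiv> 1 :: nat"
abbreviation (input) "rState \<equiv> 2 :: nat"
abbreviation (input) "rPos \<equiv> 3 :: nat"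
abbreviation (input) "rTop \<equiv> 4 :: nat"
abbreviation (input) "rStackHash \<equiv> 5 :: nat"
abbreviation (input) "rInputHash \<equiv> 6 :: nat"
abbreviation (input) "rMod \<equiv> 7 :: nat"
abbreviation (input) "rBase \<equiv> 8 :: nat"
abbreviation (input) "rLo \<equiv> 9 :: nat"
abbreviation (input) "rHi \<equiv> 10 :: nat"
abbreviation (input) "rWidth \<equiv> 11 :: nat"
abbreviation (input) "rPow \<equiv> 12 :: nat"
abbreviation (input) "rOne \<equiv> 13 :: nat"
abbreviation (input) "rA \<equiv> 14 :: nat"
abbreviation (input) "rB \<equiv> 15 :: nat"
abbreviation (input) "rC \<equiv> 16 :: nat"

text \<open>Holds between the macros. As the scratch registers are 0, a macro can restore the store
  exactly, and adding \<open>rA\<close> copies a register.\<close>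

definition clean :: "store \<Rightarrow> bool" where
  "clean \<sigma> \<longleftrightarrow> \<sigma> rOne = 1 \<and> \<sigma> rPow = 0 \<and> \<sigma> rA = 0 \<and> \<sigma> rB = 0 \<and> \<sigma> rC = 0"

text \<open>One of the two truncated differences is 0, so their sum is the distance. The scratch
  registers are cleared before either branch, which therefore starts in the original store.\<close>

definition if_eq :: "nat \<Rightarrow> nat \<Rightarrow> com \<Rightarrow> com \<Rightarrow> com" where
  "if_eq x y c d = Op rA Sub x y ;; Op rB Sub y x ;; Op rA Add rA rB ;; Const rB 0 ;;
     If rA (Const rA 0 ;; d) c"

lemma diff_plus_diff_less: "(x::nat) < z \<Longrightarrow> y < z \<Longrightarrow> x - y + (y - x) < z"
  by linarith

lemma wp_if_eq:
  assumes "clean \<sigma>" "0 < m" "x < 14" "y < 14"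
    and "\<sigma> x = \<sigma> y \<Longrightarrow> wp m c Q (\<sigma>, \<omega>)" "\<sigma> x \<noteq> \<sigma> y \<Longrightarrow> wp m d Q (\<sigma>, \<omega>)"
  shows "wp m (if_eq x y c d) Q (\<sigma>, \<omega>)"
proof (rule wp_bndI)
  assume b: "bnd m (fst (\<sigma>, \<omega>))"
  have lt: "\<sigma> x - \<sigma> y + (\<sigma> y - \<sigma> x) < 2 ^ m"
    using bndD[of m \<sigma>] b assms(3,4) by (auto intro!: diff_plus_diff_less)
  show "wp m (if_eq x y c d) Q (\<sigma>, \<omega>)"
    unfolding if_eq_def
    by (intro wp_Seq wp_Const wp_Sub wp_Add wp_If wp_store_eq[OF assms(5)] wp_store_eq[OF assms(6)])
       (use assms(1-4) lt in \<open>auto simp: clean_def fun_eq_iff\<close>)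
qed

definition if_const :: "nat \<Rightarrow> nat \<Rightarrow> com \<Rightarrow> com \<Rightarrow> com" where
  "if_const x v c d = Const rC v ;; Op rA Sub x rC ;; Op rB Sub rC x ;; Op rA Add rA rB ;;
     Const rB 0 ;; Const rC 0 ;; If rA (Const rA 0 ;; d) c"

lemma wp_if_const:
  assumes "clean \<sigma>" "0 < m" "x < 14" "v < 2 ^ m"
    and "\<sigma> x = v \<Longrightarrow> wp m c Q (\<sigma>, \<omega>)" "\<sigma> x \<noteq> v \<Longrightarrow> wp m d Q (\<sigma>, \<omega>)"
  shows "wp m (if_const x v c d) Q (\<sigma>, \<omega>)"
proof (rule wp_bndI)
  assume b: "bnd m (fst (\<sigma>, \<omega>))"
  have lt: "\<sigma> x - v + (v - \<sigma> x) < 2 ^ m"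
    using bndD[of m \<sigma>] b assms(3,4) by (auto intro!: diff_plus_diff_less)
  show "wp m (if_const x v c d) Q (\<sigma>, \<omega>)"
    unfolding if_const_def
    by (intro wp_Seq wp_Const wp_Sub wp_Add wp_If wp_store_eq[OF assms(5)] wp_store_eq[OF assms(6)])
       (use assms(1-4) lt in \<open>auto simp: clean_def fun_eq_iff\<close>)
qed

fun if_member :: "nat \<Rightarrow> nat list \<Rightarrow> com \<Rightarrow> com \<Rightarrow> com" where
  "if_member x [] c d = d"
| "if_member x (v # vs) c d = if_const x v c (if_member x vs c d)"

lemma wp_if_member:
  assumes "clean \<sigma>" "0 < m" "x < 14" "\<forall>v\<in>set vs. v < 2 ^ m"
    and "\<sigma> x \<in> set vs \<Longrightarrow> wp m c Q (\<sigma>, \<omega>)" "\<sigma> x \<notin> set vs \<Longrightarrow> wp m d Q (\<sigma>, \<omega>)"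
  shows "wp m (if_member x vs c d) Q (\<sigma>, \<omega>)"
  using assms(4-)
proof (induction vs)
  case (Cons v vs)
  show ?case
    unfolding if_member.simps
    by (intro wp_if_const[OF assms(1-3)] Cons.IH) (use Cons.prems in auto)
qed simp

text \<open>The power is recomputed from scratch each time: positions on the stack descend, where
  updating a power would mean dividing by the base. Outside the window \<open>rPow\<close> keeps its
  0. The initial 1 is reduced as well, so that the loop invariant \<open>rBase ^ d mod rMod\<close>
  holds literally for d = 0.\<close>

definition set_weight :: "nat \<Rightarrow> com" where
  "set_weight x = Op rA Sub rHi x ;;
     If rA
       (Op rA Sub rLo x ;;
        If rA (Const rA 0)
          (Op rA Sub x rLo ;; Const rPow 1 ;; Op rPow Mod rPow rMod ;;
           While rA (Op rPow Mul rPow rBase ;; Op rPow Mod rPow rMod ;; Op rA Sub rA rOne)))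
       Skip"

text \<open>Room is demanded only for exponents that occur inside the window: when nothing is
  reduced, larger powers would not fit.\<close>

lemma wp_set_weight:
  assumes "clean \<sigma>" "0 < m" "x < 12"
    and room: "\<And>d. \<sigma> rLo + d < \<sigma> rHi \<Longrightarrow> (\<sigma> rBase ^ d mod \<sigma> rMod) * \<sigma> rBase < 2 ^ m"
    and Q: "Q (\<sigma>(rPow := weight (\<sigma> rBase) (\<sigma> rLo) (\<sigma> rHi) (\<sigma> x) mod \<sigma> rMod), \<omega>)"
  shows "wp m (set_weight x) Q (\<sigma>, \<omega>)"
proof -
  let ?w = "weight (\<sigma> rBase) (\<sigma> rLo) (\<sigma> rHi) (\<sigma> x)"
  have eq: "Q (\<sigma>', \<omega>)" if "\<sigma>' = \<sigma>(rPow := ?w mod \<sigma> rMod)" for \<sigma>'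
    using that Q by simp
  have loop: "wp m (While rA (Op rPow Mul rPow rBase ;; Op rPow Mod rPow rMod ;; Op rA Sub rA rOne)) Q
      (\<sigma>(rPow := 1 mod \<sigma> rMod, rA := \<sigma> x - \<sigma> rLo), \<omega>)"
    if *: "\<sigma> x < \<sigma> rHi" "\<sigma> rLo \<le> \<sigma> x"
  proof (rule wp_While[where \<mu> = "\<lambda>\<sigma>. \<sigma> rA" and I = "\<lambda>\<sigma>' \<omega>'. \<omega>' = \<omega> \<and> (\<exists>d. d \<le> \<sigma> x - \<sigma> rLo \<and>
      \<sigma>' = \<sigma>(rPow := \<sigma> rBase ^ d mod \<sigma> rMod, rA := \<sigma> x - \<sigma> rLo - d))"], goal_cases)
    case 1
    show ?case by (auto intro!: exI[of _ 0])
  next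
    case (2 \<sigma>' \<omega>')
    then obtain d where d0: "d \<le> \<sigma> x - \<sigma> rLo" and d: "\<omega>' = \<omega>"
      "\<sigma>' = \<sigma>(rPow := \<sigma> rBase ^ d mod \<sigma> rMod, rA := \<sigma> x - \<sigma> rLo - d)" by blast
    have d1: "d < \<sigma> x - \<sigma> rLo" using 2(2) d0 unfolding d by simp
    have r: "(\<sigma> rBase ^ d mod \<sigma> rMod) * \<sigma> rBase < 2 ^ m" using room[of d] d1 * by auto
    have m: "((\<sigma> rBase ^ d mod \<sigma> rMod) * \<sigma> rBase) mod \<sigma> rMod = \<sigma> rBase ^ Suc d mod \<sigma> rMod"
      by (simp add: mod_simps mult.commute)
    show ?case unfolding d
      by (intro wp_Seq wp_Mul wp_Mod wp_Sub)
         (use assms(1,2) r m d1 in \<open>auto simp: clean_def fun_eq_iff intro!: exI[of _ "Suc d"]\<close>)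
  next
    case (3 \<sigma>' \<omega>')
    then obtain d where d: "d \<le> \<sigma> x - \<sigma> rLo" "\<omega>' = \<omega>"
      "\<sigma>' = \<sigma>(rPow := \<sigma> rBase ^ d mod \<sigma> rMod, rA := \<sigma> x - \<sigma> rLo - d)" by blast
    moreover have "d = \<sigma> x - \<sigma> rLo" using 3(2) d by simp
    ultimately show ?case using assms(1) * by (auto intro!: eq simp: weight_def clean_def fun_eq_iff)
  qed
  show ?thesis unfolding set_weight_def
    by (intro wp_Seq wp_Sub wp_If wp_Const wp_Mod wp_Skip wp_store_eq[OF loop] eq)
       (use assms(1-3) one_less_power[of "2::nat" m] in \<open>auto simp: clean_def fun_eq_iff weight_def\<close>)
qed

definition add_letter :: "nat \<Rightarrow> nat \<Rightarrow> nat \<Rightarrow> com" where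
  "add_letter h x v = set_weight x ;; Const rB v ;; Op rPow Mul rPow rB ;; Op h Add h rPow ;;
     Op h Mod h rMod ;; Const rPow 0 ;; Const rB 0"

lemma wp_add_letter:
  assumes "clean \<sigma>" "0 < m" "x < 12" "h \<in> {rStackHash, rInputHash}"
    and room: "\<And>d. \<sigma> rLo + d < \<sigma> rHi \<Longrightarrow> (\<sigma> rBase ^ d mod \<sigma> rMod) * \<sigma> rBase < 2 ^ m"
    "\<And>d. \<sigma> rLo + d < \<sigma> rHi \<Longrightarrow> \<sigma> h + (\<sigma> rBase ^ d mod \<sigma> rMod) * v < 2 ^ m"
    and v: "v < 2 ^ m"
    and Q: "Q (\<sigma>(h := (\<sigma> h + v * weight (\<sigma> rBase) (\<sigma> rLo) (\<sigma> rHi) (\<sigma> x)) mod \<sigma> rMod), \<omega>)"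
  shows "wp m (add_letter h x v) Q (\<sigma>, \<omega>)"
proof -
  let ?w = "weight (\<sigma> rBase) (\<sigma> rLo) (\<sigma> rHi) (\<sigma> x)"
  have le: "\<sigma> h + (?w mod \<sigma> rMod) * v < 2 ^ m" if "bnd m (fst (\<sigma>, \<omega>))"
    using room(2)[of "\<sigma> x - \<sigma> rLo"] bndD[of m \<sigma> h] that assms(4) by (auto simp: weight_def)
  have mod: "(\<sigma> h + (?w mod \<sigma> rMod) * v) mod \<sigma> rMod = (\<sigma> h + v * ?w) mod \<sigma> rMod"
    unfolding mult.commute[of v] by (intro mod_add_cong refl mod_mult_left_eq)
  have eq: "Q (\<sigma>', \<omega>)" if "\<sigma>' = \<sigma>(h := (\<sigma> h + v * ?w) mod \<sigma> rMod)" for \<sigma>'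
    using that Q by simp
  show ?thesis unfolding add_letter_def
    by (rule wp_bndI, frule le) (intro wp_Seq wp_set_weight wp_Const wp_Mul wp_Add wp_Mod eq,
       use assms(1-4) mod room(1) v in \<open>auto simp: clean_def fun_eq_iff\<close>)
qed

text \<open>The last letter goes first, since it is adjacent to the old stack and the top moves to
  smaller positions.\<close>

fun push :: "('a \<Rightarrow> nat) \<Rightarrow> 'a list \<Rightarrow> com" where
  "push c [] = Skip"
| "push c (a # u) = push c u ;; Op rTop Sub rTop rOne ;; add_letter rStackHash rTop (c a)"

text \<open>\<open>rPos\<close> does not yet count the letter being read, so the strict test says
  exactly that the enlarged stack fits into the rest of the input. It also keeps the decrements of
  \<open>rTop\<close> from being truncated.\<close>

definition goto :: "('a \<Rightarrow> nat) \<Rightarrow> nat \<Rightarrow> 'a list \<Rightarrow> com" where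
  "goto c p u = Const rC (length u) ;; Op rC Add rC rPos ;; Op rA Sub rTop rC ;; Const rC 0 ;;
     If rA (Const rA 0 ;; push c u ;; Const rState p) (Const rState 0)"

fun step :: "('a \<Rightarrow> nat) \<Rightarrow> 'a \<Rightarrow> 'a trans list \<Rightarrow> com" where
  "step c a [] = Const rState 0"
| "step c a ((p, b, p', u) # ts) =
     (if b = a then if_const rState p (goto c p' u) (step c a ts) else step c a ts)"

text \<open>When stack and rest have equal length, the derivation must have ended. State 1 is in the
  list because the invariant leaves \<open>rTop\<close> open during the comparison, which must not
  be aborted.\<close>

definition settle :: "nat list \<Rightarrow> com" where
  "settle fs = if_eq rTop rPos (if_member rState (1 # fs) (Const rState 1) (Const rState 0)) Skip"

definition letter :: "('a \<Rightarrow> nat) \<Rightarrow> 'a trans list \<Rightarrow> nat list \<Rightarrow> 'a \<Rightarrow> com" where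
  "letter c ts fs a = if_const rState 1 (add_letter rInputHash rPos (c a)) (step c a ts) ;;
     Op rPos Add rPos rOne ;; settle fs"

text \<open>\<open>settle\<close> is called here for the empty input, where the empty stack and the
  rest have equal length from the start.\<close>

definition begin_pass :: "nat list \<Rightarrow> nat \<Rightarrow> com" where
  "begin_pass fs q0 = Const rState q0 ;; Const rPos 0 ;; Op rTop Add rLen rA ;;
     Const rStackHash 0 ;; Const rInputHash 0 ;; settle fs"

text \<open>The verdict is only ever cleared, so it is the conjunction over all windows. The program
  does not know which pass is the last, so it always moves the window and prepares another
  pass.\<close>

definition finish_pass :: "nat list \<Rightarrow> nat \<Rightarrow> com" where
  "finish_pass fs q0 =
     if_const rState 1 (if_eq rStackHash rInputHash Skip (Const rVerdict 0)) (Const rVerdict 0) ;;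
     Op rLo Add rHi rA ;; Op rHi Add rHi rWidth ;; begin_pass fs q0"

definition algorithm :: "com \<Rightarrow> ('a \<Rightarrow> nat) \<Rightarrow> 'a trans list \<Rightarrow> nat list \<Rightarrow> nat \<Rightarrow> 'a stream_alg" where
  "algorithm c\<^sub>0 c ts fs q0 = \<lparr>num_regs = 17, init = c\<^sub>0 ;; begin_pass fs q0,
     on_letter = letter c ts fs, end_pass = finish_pass fs q0\<rparr>"

text \<open>The outcome of one pass. The compared suffixes start at position
  \<open>length x - length w\<close>.\<close>

definition hashes_agree :: "('a \<Rightarrow> nat) \<Rightarrow> 'a trans list \<Rightarrow> nat list \<Rightarrow> nat \<Rightarrow> nat \<Rightarrow> nat \<Rightarrow> nat \<Rightarrow> nat \<Rightarrow> 'a list \<Rightarrow> bool" where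
  "hashes_agree c ts fs q0 q r lo hi x \<longleftrightarrow> (\<exists>y w. scan (set ts) (set fs) q0 x [] = Some (y, w) \<and>
     hash c r lo hi (length x - length w) y mod q = hash c r lo hi (length x - length w) w mod q)"

text \<open>Common setting of both algorithms: \<open>m\<close> bits per register, input length
  \<open>n\<close>, window width \<open>l\<close>, and either a prime \<open>q\<close> with a point
  \<open>r\<close> or \<open>q = 0\<close> with a base \<open>r\<close>. The two room assumptions
  bound the intermediate results before reduction.\<close>

locale streaming =
  fixes c :: "'a \<Rightarrow> nat" and A :: "'a set" and ts :: "'a trans list" and fs :: "nat list"
    and q0 m n q r l :: nat
  assumes m: "0 < m"
    and det: "deterministic (set ts)"
    and ts: "\<And>p a p' u. (p, a, p', u) \<in> set ts \<Longrightarrow>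
      2 \<le> p \<and> 2 \<le> p' \<and> p < 2 ^ m \<and> p' < 2 ^ m \<and> length u + n < 2 ^ m \<and> set u \<subseteq> A"
    and fs: "\<And>p. p \<in> set fs \<Longrightarrow> 2 \<le> p \<and> p < 2 ^ m"
    and q0: "2 \<le> q0" "q0 < 2 ^ m"
    and code: "\<And>a. a \<in> A \<Longrightarrow> c a < 2 ^ m"
    and n: "n + 1 < 2 ^ m"
    and pow_room: "\<And>d. d < l \<Longrightarrow> (r ^ d mod q) * r < 2 ^ m"
    and hash_room: "\<And>d lo i z a. d < l \<Longrightarrow> a \<in> A \<Longrightarrow> set z \<subseteq> A \<Longrightarrow>
      hash c r lo (lo + l) i z mod q + (r ^ d mod q) * c a < 2 ^ m"
begin

section \<open>Invariant of a pass\<close>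

abbreviation "T \<equiv> set ts"
abbreviation "F \<equiv> set fs"
abbreviation "h lo i z \<equiv> hash c r lo (lo + l) i z mod q"

definition base :: "nat \<Rightarrow> nat \<Rightarrow> store \<Rightarrow> bool" where
  "base lo v \<sigma> \<longleftrightarrow> clean \<sigma> \<and> \<sigma> rLen = n \<and> \<sigma> rVerdict = v \<and> \<sigma> rMod = q \<and> \<sigma> rBase = r \<and>
     \<sigma> rLo = lo \<and> \<sigma> rHi = lo + l \<and> \<sigma> rWidth = l"

text \<open>Here \<open>x\<close> is the whole input and \<open>z\<close> the unread rest; in state
  1, \<open>y\<close> is the part of the suffix already hashed. \<open>strict\<close> holds after
  \<open>settle\<close>: the stack is then shorter than the rest, as needed to follow a transition
  on the next letter.\<close>

definition phase :: "nat \<Rightarrow> bool \<Rightarrow> 'a list \<Rightarrow> 'a list \<Rightarrow> store \<Rightarrow> bool" where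
  "phase lo strict x z \<sigma> \<longleftrightarrow>
     \<sigma> rState = 0 \<and> scan T F q0 x [] = None \<or>
     \<sigma> rState = 1 \<and> (\<exists>y w. scan T F q0 x [] = Some (y @ z, w) \<and> length y + length z = length w \<and>
        length w \<le> n \<and> set w \<subseteq> A \<and> set y \<subseteq> A \<and>
        \<sigma> rStackHash = h lo (n - length w) w \<and> \<sigma> rInputHash = h lo (n - length w) y) \<or>
     2 \<le> \<sigma> rState \<and> (\<exists>w. scan T F q0 x [] = scan T F (\<sigma> rState) z w \<and> length w \<le> length z \<and>
        (strict \<longrightarrow> length w < length z) \<and> set w \<subseteq> A \<and> \<sigma> rTop = n - length w \<and>
        \<sigma> rStackHash = h lo (n - length w) w \<and> \<sigma> rInputHash = 0)"

definition inv :: "nat \<Rightarrow> nat \<Rightarrow> 'a list \<Rightarrow> 'a list \<Rightarrow> store \<Rightarrow> bool" where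
  "inv lo v x z \<sigma> \<longleftrightarrow> base lo v \<sigma> \<and> \<sigma> rPos + length z = n \<and> phase lo True x z \<sigma>"

lemma phase_cases [consumes 1, case_names dead compare active]:
  assumes "phase lo strict x z \<sigma>"
  obtains "\<sigma> rState = 0" "scan T F q0 x [] = None"
  | y w where "\<sigma> rState = 1" "scan T F q0 x [] = Some (y @ z, w)" "length y + length z = length w"
      "length w \<le> n" "set w \<subseteq> A" "set y \<subseteq> A"
      "\<sigma> rStackHash = h lo (n - length w) w" "\<sigma> rInputHash = h lo (n - length w) y"
  | w where "2 \<le> \<sigma> rState" "scan T F q0 x [] = scan T F (\<sigma> rState) z w" "length w \<le> length z"
      "strict \<Longrightarrow> length w < length z" "set w \<subseteq> A" "\<sigma> rTop = n - length w"
      "\<sigma> rStackHash = h lo (n - length w) w" "\<sigma> rInputHash = 0"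
proof -
  from assms show thesis unfolding phase_def
  proof (elim disjE exE conjE, goal_cases)
    case 1
    then show ?thesis by (rule that(1))
  next
    case (2 y w)
    then show ?thesis by (rule that(2))
  next
    case (3 w)
    then show ?thesis by (intro that(3)[of w]) simp_all
  qed
qed

lemma phase_dead: "\<sigma> rState = 0 \<Longrightarrow> scan T F q0 x [] = None \<Longrightarrow> phase lo strict x z \<sigma>"
  by (simp add: phase_def)

lemma phase_compare:
  assumes "\<sigma> rState = 1" "scan T F q0 x [] = Some (y @ z, w)" "length y + length z = length w"
      "length w \<le> n" "set w \<subseteq> A" "set y \<subseteq> A"
      "\<sigma> rStackHash = h lo (n - length w) w" "\<sigma> rInputHash = h lo (n - length w) y"
  shows "phase lo strict x z \<sigma>"
  unfolding phase_def using assms by blast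

lemma phase_active:
  assumes "2 \<le> \<sigma> rState" "scan T F q0 x [] = scan T F (\<sigma> rState) z w" "length w \<le> length z"
      "strict \<Longrightarrow> length w < length z" "set w \<subseteq> A" "\<sigma> rTop = n - length w"
      "\<sigma> rStackHash = h lo (n - length w) w" "\<sigma> rInputHash = 0"
  shows "phase lo strict x z \<sigma>"
  unfolding phase_def using assms by blast

lemma less_power_m: "2 < (2::nat) ^ m" "1 < (2::nat) ^ m"
  using q0 by auto

text \<open>At equal lengths \<open>scan\<close> stops and only the state decides; otherwise the
  inequality of \<open>rTop\<close> and \<open>rPos\<close> turns \<le> into <.\<close>

lemma wp_settle:
  assumes "base lo v \<sigma>" "\<sigma> rPos + length z = n" "phase lo False x z \<sigma>"
  shows "wp m (settle fs) (\<lambda>(\<sigma>', \<omega>'). \<omega>' = \<omega> \<and> inv lo v x z \<sigma>') (\<sigma>, \<omega>)"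
  unfolding settle_def
proof (rule wp_if_eq)
  assume neq: "\<sigma> rTop \<noteq> \<sigma> rPos"
  from assms(3) have "phase lo True x z \<sigma>"
  proof (cases rule: phase_cases)
    case (active w)
    then show ?thesis using neq assms(2) by (intro phase_active[of _ _ _ w]) (auto simp: le_less)
  qed (auto intro: phase_dead phase_compare)
  then show "wp m Skip (\<lambda>(\<sigma>', \<omega>'). \<omega>' = \<omega> \<and> inv lo v x z \<sigma>') (\<sigma>, \<omega>)"
    using assms by (auto intro!: wp_Skip simp: inv_def)
next
  assume eq: "\<sigma> rTop = \<sigma> rPos"
  show "wp m (if_member rState (1 # fs) (Const rState 1) (Const rState 0))
      (\<lambda>(\<sigma>', \<omega>'). \<omega>' = \<omega> \<and> inv lo v x z \<sigma>') (\<sigma>, \<omega>)"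
  proof (rule wp_if_member)
    assume mem: "\<sigma> rState \<in> set (1 # fs)"
    from assms(3) have "phase lo True x z (\<sigma>(rState := 1))"
    proof (cases rule: phase_cases)
      case dead
      then show ?thesis using mem fs by fastforce
    next
      case (compare y w)
      then show ?thesis by (intro phase_compare) auto
    next
      case (active w)
      then have "length w = length z" using eq assms(2) by auto
      moreover have "\<sigma> rState \<in> F" using active mem by auto
      ultimately show ?thesis using active assms(2)
        by (intro phase_compare[of _ _ "[]" _ w]) (auto simp: scan_eq_length)
    qed
    then show "wp m (Const rState 1) (\<lambda>(\<sigma>', \<omega>'). \<omega>' = \<omega> \<and> inv lo v x z \<sigma>') (\<sigma>, \<omega>)"
      using assms(1,2) m less_power_m by (intro wp_Const) (auto simp: inv_def base_def clean_def)
  next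
    assume mem: "\<sigma> rState \<notin> set (1 # fs)"
    from assms(3) have "phase lo True x z (\<sigma>(rState := 0))"
    proof (cases rule: phase_cases)
      case dead
      then show ?thesis by (intro phase_dead) auto
    next
      case (compare y w)
      then show ?thesis using mem by auto
    next
      case (active w)
      then have "length w = length z" using eq assms(2) by auto
      moreover have "\<sigma> rState \<notin> F" using active mem by auto
      ultimately show ?thesis using active
        by (intro phase_dead) (auto simp: scan_eq_length)
    qed
    then show "wp m (Const rState 0) (\<lambda>(\<sigma>', \<omega>'). \<omega>' = \<omega> \<and> inv lo v x z \<sigma>') (\<sigma>, \<omega>)"
      using assms(1,2) m by (intro wp_Const) (auto simp: inv_def base_def clean_def)
  qed (use assms m fs less_power_m in \<open>auto simp: base_def\<close>)
qed (use assms m in \<open>auto simp: base_def\<close>)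

lemma wp_push:
  assumes "base lo v \<sigma>" "length u \<le> \<sigma> rTop" "set u \<subseteq> A" "set w \<subseteq> A"
    and "\<sigma> rStackHash = h lo (\<sigma> rTop) w"
    and "Q (\<sigma>(rTop := \<sigma> rTop - length u, rStackHash := h lo (\<sigma> rTop - length u) (u @ w)), \<omega>)"
  shows "wp m (push c u) Q (\<sigma>, \<omega>)"
  using assms(2,3,6)
proof (induction u arbitrary: Q)
  case Nil
  have "\<sigma>(rTop := \<sigma> rTop, rStackHash := h lo (\<sigma> rTop) w) = \<sigma>" using assms(5) by (auto simp: fun_eq_iff)
  then show ?case using Nil by (auto intro!: wp_Skip)
next
  case (Cons a u)
  let ?\<sigma> = "\<sigma>(rTop := \<sigma> rTop - length (a # u), rStackHash := h lo (\<sigma> rTop - length u) (u @ w))"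
  have eq: "Q (\<sigma>', \<omega>)"
    if "\<sigma>' = \<sigma>(rTop := \<sigma> rTop - length (a # u), rStackHash := h lo (\<sigma> rTop - length (a # u)) ((a # u) @ w))" for \<sigma>'
    using that Cons.prems(3) by (simp only:)
  have Suc: "\<sigma> rTop - length u = Suc (\<sigma> rTop - length (a # u))" using Cons.prems by simp
  have clean: "clean ?\<sigma>" using assms(1) by (simp add: base_def clean_def)
  have add: "wp m (add_letter rStackHash rTop (c a)) Q (?\<sigma>, \<omega>)"
    by (intro wp_add_letter[OF clean m] eq)
       (use assms(1,4) Cons.prems pow_room hash_room[of _ a "u @ w"] code Suc
         in \<open>auto simp: base_def fun_eq_iff add.commute mod_simps\<close>)
  show ?case unfolding push.simps
    by (intro wp_Seq Cons.IH wp_Sub wp_store_eq[OF add])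
       (use Cons.prems assms(1) m in \<open>auto simp: base_def clean_def fun_eq_iff\<close>)
qed

text \<open>Afterwards the phase already refers to \<open>z\<close>, whereas \<open>rPos\<close>
  still refers to \<open>a # z\<close> until it is incremented. If the new stack is too long,
  \<open>scan\<close> fails on it, in accordance with state 0.\<close>

lemma wp_goto:
  assumes "base lo v \<sigma>" "\<sigma> rPos + length (a # z) = n" "phase lo True x (a # z) \<sigma>"
    and t: "(\<sigma> rState, a, p, u) \<in> T"
  shows "wp m (goto c p u) (\<lambda>(\<sigma>', \<omega>'). \<omega>' = \<omega> \<and>
    base lo v \<sigma>' \<and> \<sigma>' rPos + length (a # z) = n \<and> phase lo False x z \<sigma>') (\<sigma>, \<omega>)"
    (is "wp m _ ?Q _")
proof -
  note T = ts[OF t]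
  note b = assms(1)[unfolded base_def clean_def One_nat_def]
  have pos: "\<sigma> rPos = n - Suc (length z)" "Suc (length z) \<le> n" using assms(2) by auto
  obtain w where w: "scan T F q0 x [] = scan T F (\<sigma> rState) (a # z) w" "length w < length (a # z)"
      "set w \<subseteq> A" "\<sigma> rTop = n - length w" "\<sigma> rStackHash = h lo (n - length w) w" "\<sigma> rInputHash = 0"
    using assms(3) T by (cases rule: phase_cases) auto
  have scan: "scan T F q0 x [] = scan T F p z (u @ w)"
    using w(1,2) scan_trans[OF det t, of w z] by simp
  have fits: "length u + \<sigma> rPos < \<sigma> rTop \<longleftrightarrow> length (u @ w) \<le> length z"
    using assms(2) w(2,4) by auto
  have push: "wp m (push c u) (wp m (Const rState p) ?Q) (\<sigma>, \<omega>)" if "length u + \<sigma> rPos < \<sigma> rTop"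
  proof -
    have le: "length (u @ w) \<le> length z" using that fits by blast
    have eq: "\<sigma> rTop - length u = n - length (u @ w)" using w(4) by simp
    let ?\<sigma> = "\<sigma>(rTop := n - length (u @ w), rStackHash := h lo (n - length (u @ w)) (u @ w))"
    have "phase lo False x z (?\<sigma>(rState := p))"
      using T scan w(3,6) le by (intro phase_active[where w = "u @ w"]) auto
    moreover have "base lo v (?\<sigma>(rState := p))" by (simp add: base_def clean_def b)
    ultimately have "?Q (?\<sigma>(rState := p), \<omega>)" using pos by simp
    then have const: "wp m (Const rState p) ?Q (?\<sigma>, \<omega>)" using m T by (intro wp_Const) auto
    show ?thesis
    proof (rule wp_push[OF assms(1), where w = w], goal_cases)
      case 5
      then show ?case unfolding eq by (rule const)
    qed (use that T w in auto)
  qed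
  have none: "wp m (Const rState 0) ?Q (\<sigma>, \<omega>)" if "\<not> length u + \<sigma> rPos < \<sigma> rTop"
  proof -
    have "scan T F q0 x [] = None" using scan that fits by (simp add: scan_less_length)
    then show ?thesis using pos m
      by (intro wp_Const) (auto simp: base_def clean_def b intro!: phase_dead)
  qed
  show ?thesis unfolding goto_def
    by (intro wp_Seq wp_Const wp_Add wp_Sub wp_If wp_store_eq[OF push] wp_store_eq[OF none])
       (use pos m T in \<open>auto simp: b fun_eq_iff\<close>)
qed

lemma wp_step:
  assumes "clean \<sigma>" "set ts' \<subseteq> T"
    and "\<And>p u. (\<sigma> rState, a, p, u) \<in> set ts' \<Longrightarrow> wp m (goto c p u) Q (\<sigma>, \<omega>)"
    and "(\<And>p u. (\<sigma> rState, a, p, u) \<notin> set ts') \<Longrightarrow> Q (\<sigma>(rState := 0), \<omega>)"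
  shows "wp m (step c a ts') Q (\<sigma>, \<omega>)"
  using assms(2-)
proof (induction ts')
  case Nil
  show ?case unfolding step.simps by (intro wp_Const Nil(3)) (use m in auto)
next
  case (Cons t ts')
  obtain p b p' u where t: "t = (p, b, p', u)" by (cases t)
  show ?case
  proof (cases "b = a")
    case False
    have "wp m (step c a ts') Q (\<sigma>, \<omega>)"
      by (intro Cons.IH Cons.prems(2,3)) (use Cons.prems(1) t False in auto)
    then show ?thesis using t False by simp
  next
    case True
    have "wp m (if_const rState p (goto c p' u) (step c a ts')) Q (\<sigma>, \<omega>)"
    proof (rule wp_if_const[OF assms(1) m])
      show "p < 2 ^ m" using Cons.prems(1) t ts by auto
      show "wp m (goto c p' u) Q (\<sigma>, \<omega>)" if "\<sigma> rState = p"
        by (rule Cons.prems(2)) (use that t True in auto)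
      show "wp m (step c a ts') Q (\<sigma>, \<omega>)" if "\<sigma> rState \<noteq> p"
        by (intro Cons.IH Cons.prems(2,3)) (use Cons.prems(1) t that in auto)
    qed simp
    then show ?thesis using t True by simp
  qed
qed

lemma wp_letter:
  assumes "inv lo v x (a # z) \<sigma>" "a \<in> A"
  shows "wp m (letter c ts fs a) (\<lambda>(\<sigma>', \<omega>'). \<omega>' = \<omega> \<and> inv lo v x z \<sigma>') (\<sigma>, \<omega>)"
proof -
  have b: "base lo v \<sigma>" and pos: "\<sigma> rPos + length (a # z) = n" and ph: "phase lo True x (a # z) \<sigma>"
    using assms(1) by (auto simp: inv_def)
  have clean: "clean \<sigma>" using b by (simp add: base_def)
  note b' = b[unfolded base_def clean_def One_nat_def]
  have pos': "\<sigma> rPos = n - Suc (length z)" "Suc (length z) \<le> n" using pos by auto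
  let ?P = "\<lambda>(\<sigma>', \<omega>'). \<omega>' = \<omega> \<and>
    base lo v \<sigma>' \<and> \<sigma>' rPos + length (a # z) = n \<and> phase lo False x z \<sigma>'"
  have main: "wp m (if_const rState 1 (add_letter rInputHash rPos (c a)) (step c a ts)) ?P (\<sigma>, \<omega>)"
  proof (rule wp_if_const[OF clean m])
    assume 1: "\<sigma> rState = 1"
    obtain y w where w: "scan T F q0 x [] = Some (y @ a # z, w)" "length y + length (a # z) = length w"
      "length w \<le> n" "set w \<subseteq> A" "set y \<subseteq> A"
      "\<sigma> rStackHash = h lo (n - length w) w" "\<sigma> rInputHash = h lo (n - length w) y"
      using ph 1 by (cases rule: phase_cases) auto
    have "\<sigma> rPos = n - length w + length y" using w pos by simp
    then have hash: "(h lo (n - length w) y + c a * weight r lo (lo + l) (\<sigma> rPos)) mod q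
        = h lo (n - length w) (y @ [a])"
      by (simp add: hash_append mod_simps)
    let ?\<sigma> = "\<sigma>(rInputHash := h lo (n - length w) (y @ [a]))"
    have "phase lo False x z ?\<sigma>"
      using w 1 assms(2) by (intro phase_compare[where y = "y @ [a]" and w = w]) auto
    moreover have "base lo v ?\<sigma>" by (simp add: base_def clean_def b')
    ultimately have P: "?P (?\<sigma>, \<omega>)" using pos by simp
    show "wp m (add_letter rInputHash rPos (c a)) ?P (\<sigma>, \<omega>)"
    proof (rule wp_add_letter[OF clean m], goal_cases)
      case (3 d)
      then show ?case using pow_room by (simp add: b')
    next
      case (4 d)
      then show ?case using hash_room[OF _ assms(2) w(5)] by (simp add: b' w(7))
    next
      case 6
      then show ?case using P hash by (simp add: b' w(7))
    qed (use assms(2) code in auto)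
  next
    \<comment> \<open>State 0 needs no branch of its own: transitions leave only states from 2 on,
      so \<open>step\<close> falls through and writes 0 again.\<close>
    assume not1: "\<sigma> rState \<noteq> 1"
    show "wp m (step c a ts) ?P (\<sigma>, \<omega>)"
    proof (rule wp_step[OF clean order.refl wp_goto[OF b pos ph]])
      assume none: "(\<sigma> rState, a, p, u) \<notin> T" for p u
      from ph have "scan T F q0 x [] = None"
      proof (cases rule: phase_cases)
        case (active w)
        then show ?thesis using none by (simp add: scan_no_trans)
      qed (use not1 in auto)
      then show "?P (\<sigma>(rState := 0), \<omega>)"
        using pos' by (auto simp: base_def clean_def b' intro!: phase_dead)
    qed
  qed (use less_power_m in auto)
  have rest: "wp m (Op rPos Add rPos rOne ;; settle fs) (\<lambda>(\<sigma>', \<omega>'). \<omega>' = \<omega> \<and> inv lo v x z \<sigma>') (\<sigma>', \<omega>)"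
    if "base lo v \<sigma>'" "\<sigma>' rPos + length (a # z) = n" "phase lo False x z \<sigma>'" for \<sigma>'
  proof -
    note b'' = that(1)[unfolded base_def clean_def One_nat_def]
    have "\<sigma>' rPos = n - Suc (length z)" "Suc (length z) \<le> n" using that(2) by auto
    then show ?thesis
      by (intro wp_Seq wp_Add wp_settle)
         (use m n that(3) in \<open>auto simp: b'' base_def clean_def phase_def\<close>)
  qed
  show ?thesis unfolding letter_def
  proof (rule wp_Seq, rule wp_conseq[OF main])
    fix \<kappa>' assume "?P \<kappa>'"
    then obtain \<sigma>' where "\<kappa>' = (\<sigma>', \<omega>)" "base lo v \<sigma>'" "\<sigma>' rPos + length (a # z) = n"
      "phase lo False x z \<sigma>'" by (cases \<kappa>') simp
    then show "wp m (Op rPos Add rPos rOne ;; settle fs)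
        (\<lambda>(\<sigma>', \<omega>'). \<omega>' = \<omega> \<and> inv lo v x z \<sigma>') \<kappa>'"
      using rest by blast
  qed
qed

lemma wp_begin_pass:
  assumes "base lo v \<sigma>" "length x = n"
  shows "wp m (begin_pass fs q0) (\<lambda>(\<sigma>', \<omega>'). \<omega>' = \<omega> \<and> inv lo v x x \<sigma>') (\<sigma>, \<omega>)"
  unfolding begin_pass_def
  by (intro wp_Seq wp_Const wp_Add wp_settle phase_active[where w = "[]"])
     (use assms(2) m n q0 in \<open>auto simp: base_def clean_def assms(1)[unfolded base_def clean_def One_nat_def]\<close>)

lemma wp_finish_pass:
  assumes "inv lo v x [] \<sigma>" "length x = n" "lo + 2 * l < 2 ^ m"
  shows "wp m (finish_pass fs q0) (\<lambda>(\<sigma>', \<omega>'). \<omega>' = \<omega> \<and>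
    inv (lo + l) (if hashes_agree c ts fs q0 q r lo (lo + l) x then v else 0) x x \<sigma>') (\<sigma>, \<omega>)"
    (is "wp m _ (\<lambda>(\<sigma>', \<omega>'). \<omega>' = \<omega> \<and> inv (lo + l) ?v x x \<sigma>') _")
proof -
  have b: "base lo v \<sigma>" and pos: "\<sigma> rPos = n" and ph: "phase lo True x [] \<sigma>"
    using assms(1) by (auto simp: inv_def)
  have clean: "clean \<sigma>" using b by (simp add: base_def)
  note b' = b[unfolded base_def clean_def One_nat_def]
  have unchanged: "base lo v \<sigma>" and zero: "base lo 0 (\<sigma>(rVerdict := 0))"
    by (simp_all add: base_def clean_def b')
  let ?P = "\<lambda>(\<sigma>', \<omega>'). \<omega>' = \<omega> \<and> base lo ?v \<sigma>'"
  have main: "wp m (if_const rState 1 (if_eq rStackHash rInputHash Skip (Const rVerdict 0))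
      (Const rVerdict 0)) ?P (\<sigma>, \<omega>)"
    using ph
  proof (cases rule: phase_cases)
    case dead
    then have "?v = 0" by (simp add: hashes_agree_def)
    then show ?thesis
      by (intro wp_if_const[OF clean m]) (use dead zero m less_power_m in \<open>auto intro!: wp_Const\<close>)
  next
    case (compare y w)
    then have "?v = (if \<sigma> rStackHash = \<sigma> rInputHash then v else 0)"
      using assms(2) by (auto simp: hashes_agree_def)
    then show ?thesis
      by (intro wp_if_const[OF clean m] wp_if_eq[OF clean m])
         (use compare(1) unchanged zero m less_power_m in \<open>auto intro!: wp_Const wp_Skip\<close>)
  next
    \<comment> \<open>Impossible: the stack would be shorter than the empty rest.\<close>
    case (active w)
    then show ?thesis by auto
  qed
  have rest: "wp m (Op rLo Add rHi rA ;; Op rHi Add rHi rWidth ;; begin_pass fs q0)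
      (\<lambda>(\<sigma>', \<omega>'). \<omega>' = \<omega> \<and> inv (lo + l) ?v x x \<sigma>') (\<sigma>', \<omega>)" if "base lo ?v \<sigma>'" for \<sigma>'
    by (intro wp_Seq wp_Add wp_begin_pass)
       (use assms(2,3) m in \<open>auto simp: base_def clean_def that[unfolded base_def clean_def One_nat_def]\<close>)
  show ?thesis unfolding finish_pass_def
  proof (rule wp_Seq, rule wp_conseq[OF main])
    fix \<kappa>' assume "?P \<kappa>'"
    then obtain \<sigma>' where "\<kappa>' = (\<sigma>', \<omega>)" "base lo ?v \<sigma>'" by (cases \<kappa>') simp
    then show "wp m (Op rLo Add rHi rA ;; Op rHi Add rHi rWidth ;; begin_pass fs q0)
        (\<lambda>(\<sigma>', \<omega>'). \<omega>' = \<omega> \<and> inv (lo + l) ?v x x \<sigma>') \<kappa>'"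
      using rest by blast
  qed
qed

section \<open>From letters to passes and complete runs\<close>

lemma read_letters_algorithm:
  assumes "inv lo v x z \<sigma>" "bnd m \<sigma>" "set z \<subseteq> A"
  shows "\<exists>\<sigma>'. read_letters (17 * m) (algorithm c\<^sub>0 c ts fs q0) z (\<sigma>, \<omega>) (\<sigma>', \<omega>) \<and> bnd m \<sigma>' \<and> inv lo v x [] \<sigma>'"
  using assms
proof (induction z arbitrary: \<sigma>)
  case (Cons a z)
  obtain \<sigma>\<^sub>1 where 1: "exec 17 (17 * m) (letter c ts fs a) (\<sigma>, \<omega>) (\<sigma>\<^sub>1, \<omega>)" "bnd m \<sigma>\<^sub>1" "inv lo v x z \<sigma>\<^sub>1"
    using wp_letter[OF Cons.prems(1), of \<omega>] Cons.prems(2,3) unfolding wp_def by auto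
  then show ?case using Cons.IH[OF 1(3,2)] Cons.prems(3) by (auto simp: algorithm_def)
qed auto

text \<open>The factor \<open>p + 1\<close> appears because the window is moved once more after the
  last pass, so \<open>rHi\<close> ends one width further.\<close>

lemma passes_algorithm:
  assumes "inv lo v x x \<sigma>" "bnd m \<sigma>" "set x \<subseteq> A" "length x = n" "lo + (p + 1) * l < 2 ^ m"
  shows "\<exists>\<sigma>'. passes p (17 * m) (algorithm c\<^sub>0 c ts fs q0) x (\<sigma>, \<omega>) (\<sigma>', \<omega>) \<and>
    \<sigma>' rVerdict = (if \<forall>k<p. hashes_agree c ts fs q0 q r (lo + k * l) (lo + k * l + l) x then v else 0)"
  using assms(1,2,5)
proof (induction p arbitrary: lo v \<sigma>)
  case 0
  then show ?case by (auto simp: inv_def base_def)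
next
  case (Suc p)
  let ?M = "algorithm c\<^sub>0 c ts fs q0"
  let ?v = "if hashes_agree c ts fs q0 q r lo (lo + l) x then v else 0"
  obtain \<sigma>\<^sub>1 where 1: "read_letters (17 * m) ?M x (\<sigma>, \<omega>) (\<sigma>\<^sub>1, \<omega>)" "bnd m \<sigma>\<^sub>1" "inv lo v x [] \<sigma>\<^sub>1"
    using read_letters_algorithm[OF Suc.prems(1,2) assms(3)] by blast
  have lo: "lo + 2 * l < 2 ^ m" using Suc.prems(3) by (simp add: algebra_simps)
  obtain \<sigma>\<^sub>2 where 2: "exec 17 (17 * m) (finish_pass fs q0) (\<sigma>\<^sub>1, \<omega>) (\<sigma>\<^sub>2, \<omega>)" "bnd m \<sigma>\<^sub>2" "inv (lo + l) ?v x x \<sigma>\<^sub>2"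
    using wp_finish_pass[OF 1(3) assms(4) lo, of \<omega>] 1(2) unfolding wp_def by auto
  obtain \<sigma>' where 3: "passes p (17 * m) ?M x (\<sigma>\<^sub>2, \<omega>) (\<sigma>', \<omega>)"
    "\<sigma>' rVerdict = (if \<forall>k<p. hashes_agree c ts fs q0 q r (lo + l + k * l) (lo + l + k * l + l) x then ?v else 0)"
    using Suc.IH[OF 2(3,2)] Suc.prems(3) by (auto simp: algebra_simps)
  have iff: "(\<forall>k<Suc p. hashes_agree c ts fs q0 q r (lo + k * l) (lo + k * l + l) x) \<longleftrightarrow>
    hashes_agree c ts fs q0 q r lo (lo + l) x \<and>
    (\<forall>k<p. hashes_agree c ts fs q0 q r (lo + l + k * l) (lo + l + k * l + l) x)"
    by (auto simp: All_less_Suc2 algebra_simps)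
  have "\<sigma>' rVerdict = (if \<forall>k<Suc p. hashes_agree c ts fs q0 q r (lo + k * l) (lo + k * l + l) x then v else 0)"
    unfolding iff 3(2) by auto
  moreover have "passes (Suc p) (17 * m) ?M x (\<sigma>, \<omega>) (\<sigma>', \<omega>)"
    using 1(1) 2(1) 3(1) by (auto simp: algorithm_def)
  ultimately show ?case by blast
qed

lemma run_algorithm:
  assumes "exec 17 (17 * m) c\<^sub>0 (initial_store n, \<omega>) (\<sigma>, \<omega>')" "bnd m \<sigma>" "base 0 1 \<sigma>"
    and "set x \<subseteq> A" "length x = n" "(p + 1) * l < 2 ^ m"
  shows "\<exists>\<sigma>'. run p (17 * m) (algorithm c\<^sub>0 c ts fs q0) x \<omega> (\<sigma>', \<omega>') \<and>
    (\<sigma>' 1 \<noteq> 0 \<longleftrightarrow> (\<forall>k<p. hashes_agree c ts fs q0 q r (k * l) (k * l + l) x))"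
proof -
  obtain \<sigma>\<^sub>1 where 1: "exec 17 (17 * m) (begin_pass fs q0) (\<sigma>, \<omega>') (\<sigma>\<^sub>1, \<omega>')" "bnd m \<sigma>\<^sub>1" "inv 0 1 x x \<sigma>\<^sub>1"
    using wp_begin_pass[OF assms(3,5), of \<omega>'] assms(2) unfolding wp_def by auto
  obtain \<sigma>' where 2: "passes p (17 * m) (algorithm c\<^sub>0 c ts fs q0) x (\<sigma>\<^sub>1, \<omega>') (\<sigma>', \<omega>')"
    "\<sigma>' rVerdict = (if \<forall>k<p. hashes_agree c ts fs q0 q r (0 + k * l) (0 + k * l + l) x then 1 else 0)"
    using passes_algorithm[OF 1(3,2) assms(4,5), of p] assms(6) by auto
  have "bnd m (initial_store n)" using n by (auto simp: bnd_def initial_store_def)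
  then have "fits 17 (17 * m) (initial_store n)" using m by (rule bnd_imp_fits)
  then have "run p (17 * m) (algorithm c\<^sub>0 c ts fs q0) x \<omega> (\<sigma>', \<omega>')"
    unfolding run_def using assms(1,5) 1(1) 2(1) by (auto simp: algorithm_def intro: exec.Seq)
  with 2(2) show ?thesis by (intro exI[of _ \<sigma>']) auto
qed

end

section \<open>Choosing the parameters\<close>

text \<open>\<open>rMod\<close> and \<open>rLo\<close> keep their initial 0: the hash is exact and
  the first window starts at position 0.\<close>

definition init_det :: "nat \<Rightarrow> nat \<Rightarrow> com" where
  "init_det p K = Const rVerdict 1 ;; Const rOne 1 ;; Const rC p ;; Op rWidth Div rLen rC ;;
     Op rWidth Add rWidth rOne ;; Const rC 0 ;; Op rHi Add rWidth rA ;; Const rBase K"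

section \<open>Drawing the random point\<close>

definition val :: "bool list \<Rightarrow> nat" where
  "val bs = foldl (\<lambda>v b. 2 * v + of_bool b) 0 bs"

lemma val_snoc: "val (bs @ [b]) = 2 * val bs + of_bool b"
  by (simp add: val_def)

lemma val_less: "val bs < 2 ^ length bs"
  by (induction bs rule: rev_induct) (auto simp: val_snoc, simp add: val_def)

lemma val_inject: "length bs = length bs' \<Longrightarrow> val bs = val bs' \<Longrightarrow> bs = bs'"
proof (induction bs arbitrary: bs' rule: rev_induct)
  case (snoc b bs)
  then obtain bs'' b' where bs': "bs' = bs'' @ [b']" by (cases bs' rule: rev_cases) auto
  have "2 * val bs + of_bool b = 2 * val bs'' + of_bool b'"
    using snoc.prems(2) bs' by (simp add: val_snoc)
  then have "b = b' \<and> val bs = val bs''" by (cases b; cases b') (auto, presburger+)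
  then show ?case using snoc bs' by simp
qed simp

text \<open>\<open>rMod\<close> runs through the powers of two until it reaches the target in
  \<open>rC\<close>, which fixes the number of flips. Its final value is where the search for the
  prime starts.\<close>

definition draw_bits :: com where
  "draw_bits = While rA (Op rMod Add rMod rMod ;; Op rBase Add rBase rBase ;; Flip rB ;;
     Op rBase Add rBase rB ;; Op rA Sub rC rMod)"

lemma wp_draw_bits:
  assumes m: "0 < m" "2 ^ t < (2::nat) ^ m" and len: "length \<omega> = t"
    and t: "N \<le> 2 ^ t" "\<And>j. j < t \<Longrightarrow> 2 ^ j < N"
    and init: "\<sigma> rC = N" "\<sigma> rMod = 1" "\<sigma> rBase = 0" "\<sigma> rA = N - 1"
    and Q: "\<And>z. Q (\<sigma>(rMod := 2 ^ t, rBase := val \<omega>, rB := z, rA := 0), [])"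
  shows "wp m draw_bits Q (\<sigma>, \<omega>)"
  unfolding draw_bits_def
proof (rule wp_While[where \<mu> = "\<lambda>\<sigma>. \<sigma> rA" and I = "\<lambda>\<sigma>' \<omega>'. \<exists>j z. j \<le> t \<and> \<omega>' = drop j \<omega> \<and>
    \<sigma>' = \<sigma>(rMod := 2 ^ j, rBase := val (take j \<omega>), rB := z, rA := N - 2 ^ j)"], goal_cases)
  case 1
  have "\<sigma> = \<sigma>(rMod := 1, rBase := 0, rB := \<sigma> rB, rA := N - 1)" using init by (auto simp: fun_eq_iff)
  then show ?case by (intro exI[of _ 0] exI[of _ "\<sigma> rB"]) (simp add: val_def)
next
  case (2 \<sigma>' \<omega>')
  then obtain j z where j: "j \<le> t" "\<omega>' = drop j \<omega>"
    "\<sigma>' = \<sigma>(rMod := 2 ^ j, rBase := val (take j \<omega>), rB := z, rA := N - 2 ^ j)" by blast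
  have lt: "2 ^ j < N" using 2(2) j(3) by simp
  have jt: "j < t"
  proof (rule ccontr)
    assume "\<not> j < t"
    then show False using lt t(1) j(1) by simp
  qed
  have drop: "\<omega>' = \<omega> ! j # drop (Suc j) \<omega>" using j(2) jt len by (simp add: Cons_nth_drop_Suc)
  have take: "val (take (Suc j) \<omega>) = val (take j \<omega>) + val (take j \<omega>) + of_bool (\<omega> ! j)"
    using jt len by (simp add: take_Suc_conv_app_nth val_snoc)
  have pow: "(2::nat) ^ Suc j < 2 ^ m"
    using jt m(2) power_increasing[of "Suc j" t "2::nat"] by linarith
  have v: "val (take j \<omega>) + val (take j \<omega>) + of_bool (\<omega> ! j) < 2 ^ m"
    using val_less[of "take (Suc j) \<omega>"] jt len pow unfolding take by simp
  let ?\<sigma> = "\<sigma>(rMod := 2 ^ Suc j, rBase := val (take (Suc j) \<omega>), rB := of_bool (\<omega> ! j), rA := N - 2 ^ Suc j)"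
  have next_inv: "case (\<sigma>\<^sub>1, drop (Suc j) \<omega>) of (\<sigma>\<^sub>1, \<omega>\<^sub>1) \<Rightarrow> (\<exists>j z. j \<le> t \<and> \<omega>\<^sub>1 = drop j \<omega> \<and>
      \<sigma>\<^sub>1 = \<sigma>(rMod := 2 ^ j, rBase := val (take j \<omega>), rB := z, rA := N - 2 ^ j)) \<and>
      \<sigma>\<^sub>1 rA < \<sigma>' rA" if "\<sigma>\<^sub>1 = ?\<sigma>" for \<sigma>\<^sub>1
    unfolding that prod.case
  proof (rule conjI, rule exI[of _ "Suc j"], rule exI[of _ "of_bool (\<omega> ! j)"])
    show "?\<sigma> rA < \<sigma>' rA" using diff_less_mono2[OF _ lt, of "2 ^ Suc j"] by (simp add: j(3))
  qed (use jt in auto)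
  show ?case unfolding drop
    by (rule wp_store_eq[OF _ j(3)], intro wp_Seq wp_Add wp_Flip wp_Sub next_inv)
       (use m v pow in \<open>auto simp: fun_eq_iff init(1) take\<close>)
next
  case (3 \<sigma>' \<omega>')
  then obtain j z where j: "j \<le> t" "\<omega>' = drop j \<omega>"
    "\<sigma>' = \<sigma>(rMod := 2 ^ j, rBase := val (take j \<omega>), rB := z, rA := N - 2 ^ j)" by blast
  have le: "N \<le> 2 ^ j" using 3(2) j(3) by simp
  have "j = t"
  proof (rule ccontr)
    assume "j \<noteq> t"
    then show False using le t(2)[of j] j(1) by simp
  qed
  then show ?case using Q[of z] j le len by simp
qed

section \<open>Search for the next prime\<close>

definition least_divisor :: com where
  "least_divisor = While rA (Op rB Add rB rOne ;; Op rA Mod rMod rB)"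

text \<open>The search ends at the latest with the number itself, which leaves remainder 0, so
  \<open>rB\<close> needs no more bits than \<open>rMod\<close>.\<close>

lemma wp_least_divisor:
  assumes m: "0 < m" "\<sigma> rMod < 2 ^ m"
    and init: "\<sigma> rOne = 1" "\<sigma> rB = 2" "2 \<le> \<sigma> rMod" "\<sigma> rA = \<sigma> rMod mod 2"
    and Q: "\<And>d. 2 \<le> d \<Longrightarrow> d \<le> \<sigma> rMod \<Longrightarrow> d dvd \<sigma> rMod \<Longrightarrow>
      (\<And>e. 2 \<le> e \<Longrightarrow> e < d \<Longrightarrow> \<not> e dvd \<sigma> rMod) \<Longrightarrow> Q (\<sigma>(rB := d, rA := 0), \<omega>)"
  shows "wp m least_divisor Q (\<sigma>, \<omega>)"
  unfolding least_divisor_def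
proof (rule wp_While[where \<mu> = "\<lambda>\<sigma>'. \<sigma> rMod - \<sigma>' rB" and I = "\<lambda>\<sigma>' \<omega>'. \<omega>' = \<omega> \<and> (\<exists>d. 2 \<le> d \<and> d \<le> \<sigma> rMod \<and>
    (\<forall>e. 2 \<le> e \<longrightarrow> e < d \<longrightarrow> \<not> e dvd \<sigma> rMod) \<and> \<sigma>' = \<sigma>(rB := d, rA := \<sigma> rMod mod d))"], goal_cases)
  case 1
  have "\<sigma> = \<sigma>(rB := 2, rA := \<sigma> rMod mod 2)" using init by (auto simp: fun_eq_iff)
  then show ?case using init(3) by (intro conjI refl exI[of _ 2]) auto
next
  case (2 \<sigma>' \<omega>')
  then obtain d where d: "\<omega>' = \<omega>" "2 \<le> d" "d \<le> \<sigma> rMod"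
    "\<forall>e. 2 \<le> e \<longrightarrow> e < d \<longrightarrow> \<not> e dvd \<sigma> rMod" "\<sigma>' = \<sigma>(rB := d, rA := \<sigma> rMod mod d)" by blast
  have nz: "\<sigma> rMod mod d \<noteq> 0" using 2(2) d(5) by simp
  then have lt: "d < \<sigma> rMod" using d(3) by (cases "d = \<sigma> rMod") auto
  have ndvd: "\<not> e dvd \<sigma> rMod" if "2 \<le> e" "e < Suc d" for e
    using that d(4) nz by (cases "e = d") (auto simp: dvd_eq_mod_eq_0)
  show ?case unfolding d(1,5)
    by (intro wp_Seq wp_Add wp_Mod)
       (use m init lt ndvd d(2) in \<open>auto intro!: exI[of _ "Suc d"] simp: fun_eq_iff\<close>)
next
  case (3 \<sigma>' \<omega>')
  then obtain d where d: "\<omega>' = \<omega>" "2 \<le> d" "d \<le> \<sigma> rMod"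
    "\<forall>e. 2 \<le> e \<longrightarrow> e < d \<longrightarrow> \<not> e dvd \<sigma> rMod" "\<sigma>' = \<sigma>(rB := d, rA := \<sigma> rMod mod d)" by blast
  have z: "\<sigma> rMod mod d = 0" using 3(2) d(5) by simp
  have "Q (\<sigma>(rB := d, rA := 0), \<omega>)" by (rule Q) (use d z in auto)
  then show ?case using d(1,5) z by simp
qed

text \<open>The difference left in \<open>rC\<close> is 0 exactly when the candidate is its own
  least divisor. The increment precedes the test, so the prime is strictly larger than the
  start.\<close>

definition next_prime :: com where
  "next_prime = While rC (Op rMod Add rMod rOne ;; Const rB 2 ;; Op rA Mod rMod rB ;;
     least_divisor ;; Op rC Sub rMod rB)"

lemma prime_iff_least_divisor:
  fixes d g :: nat
  assumes "2 \<le> d" "d dvd g" "\<And>e. 2 \<le> e \<Longrightarrow> e < d \<Longrightarrow> \<not> e dvd g" "0 < g"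
  shows "prime g \<longleftrightarrow> d = g"
proof
  assume "prime g"
  then show "d = g" using assms(1,2) by (auto simp: prime_nat_iff)
next
  assume "d = g"
  then show "prime g" using assms(1,3) unfolding prime_nat_iff
    by (metis One_nat_def Suc_1 assms(4) dvd_imp_le dvd_pos_nat le_neq_implies_less less_eq_Suc_le Suc_leI)
qed

text \<open>As \<open>q\<close> is the least prime above \<open>g\<close>, the loop never passes it;
  this gives both termination and the space bound.\<close>

lemma wp_next_prime:
  assumes m: "0 < m" "q < 2 ^ m"
    and q: "prime q" "g < q" "\<And>q'. prime q' \<Longrightarrow> g < q' \<Longrightarrow> q \<le> q'" "1 \<le> g"
    and init: "\<sigma> rOne = 1" "\<sigma> rMod = g" "\<sigma> rC = 1" "\<sigma> rA = 0"
    and Q: "\<And>z. Q (\<sigma>(rMod := q, rB := z, rC := 0), \<omega>)"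
  shows "wp m next_prime Q (\<sigma>, \<omega>)"
  unfolding next_prime_def
proof (rule wp_While[where \<mu> = "\<lambda>\<sigma>'. q - \<sigma>' rMod" and I = "\<lambda>\<sigma>' \<omega>'. \<omega>' = \<omega> \<and> (\<exists>k z y. g \<le> k \<and> k \<le> q \<and>
    (y = 0 \<longleftrightarrow> k = q) \<and> \<sigma>' = \<sigma>(rMod := k, rB := z, rC := y))"], goal_cases)
  case 1
  have "\<sigma> = \<sigma>(rMod := g, rB := \<sigma> rB, rC := 1)" using init by (auto simp: fun_eq_iff)
  then show ?case using q(2) by (intro conjI refl exI[of _ g] exI[of _ "\<sigma> rB"] exI[of _ 1]) auto
next
  case (2 \<sigma>' \<omega>')
  from 2(1) obtain k z y where k: "\<omega>' = \<omega>" "g \<le> k" "k \<le> q" "y = 0 \<longleftrightarrow> k = q"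
    "\<sigma>' = \<sigma>(rMod := k, rB := z, rC := y)" by (elim conjE exE) (rule that, assumption+)
  have kq: "k < q" using 2(2) k by auto
  have next_inv: "case (\<sigma>\<^sub>1, \<omega>) of (\<sigma>\<^sub>1, \<omega>\<^sub>1) \<Rightarrow> (\<omega>\<^sub>1 = \<omega> \<and> (\<exists>k z y. g \<le> k \<and> k \<le> q \<and>
      (y = 0 \<longleftrightarrow> k = q) \<and> \<sigma>\<^sub>1 = \<sigma>(rMod := k, rB := z, rC := y))) \<and> q - \<sigma>\<^sub>1 rMod < q - \<sigma>' rMod"
    if d: "2 \<le> d" "d \<le> Suc k" "d dvd Suc k" "\<And>e. 2 \<le> e \<Longrightarrow> e < d \<Longrightarrow> \<not> e dvd Suc k"
      and \<sigma>\<^sub>1: "\<sigma>\<^sub>1 = \<sigma>(rMod := Suc k, rB := d, rC := Suc k - d)" for \<sigma>\<^sub>1 d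
  proof -
    \<comment> \<open>Among the numbers above \<open>g\<close> and up to \<open>q\<close>, only
      \<open>q\<close> is prime.\<close>
    have "d = Suc k \<longleftrightarrow> Suc k = q"
      using prime_iff_least_divisor[OF d(1,3,4)] q(1) q(3)[of "Suc k"] k(2) kq by auto
    then have "Suc k - d = 0 \<longleftrightarrow> Suc k = q" using d(2) by auto
    then show ?thesis
      unfolding \<sigma>\<^sub>1 prod.case
      by (intro conjI refl exI[of _ "Suc k", OF exI[of _ d, OF exI[of _ "Suc k - d"]]]) (use kq k(2,5) in auto)
  qed
  have two: "2 < (2::nat) ^ m" "Suc k < 2 ^ m"
    using m kq k(2) q(4) by linarith+
  show ?case unfolding k(1)
    by (rule wp_store_eq[OF _ k(5)], intro wp_Seq wp_Add wp_Const wp_Mod wp_least_divisor wp_Sub next_inv)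
       (use m(1) two k(2) q(4) in \<open>auto simp: init(1,4) fun_eq_iff\<close>)
next
  case (3 \<sigma>' \<omega>')
  from 3(1) obtain k z y where k: "\<omega>' = \<omega>" "g \<le> k" "k \<le> q" "y = 0 \<longleftrightarrow> k = q"
    "\<sigma>' = \<sigma>(rMod := k, rB := z, rC := y)" by (elim conjE exE) (rule that, assumption+)
  have "y = 0" using 3(2) k(5) by simp
  then show ?case using Q[of z] k by simp
qed

section \<open>Correctness\<close>

lemma scan_Some:
  assumes "scan T F q x w = Some (y, v)" "set x \<subseteq> A" "set w \<subseteq> A"
    and "\<And>p a p' u. (p, a, p', u) \<in> T \<Longrightarrow> set u \<subseteq> A" and "deterministic T"
  shows "length y = length v \<and> length v \<le> length x \<and> set y \<subseteq> A \<and> set v \<subseteq> A"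
  using assms(1-3)
proof (induction x arbitrary: q w)
  case Nil
  then show ?case by (auto split: if_splits)
next
  case (Cons a x)
  consider "length w = length (a # x)" | "length w > length (a # x)" | "length w < Suc (length x)"
    by fastforce
  then show ?case
  proof cases
    case 1
    then show ?thesis using Cons.prems by (auto simp: scan_eq_length split: if_splits)
  next
    case 2
    then show ?thesis using Cons.prems by (simp add: scan_less_length)
  next
    case 3
    show ?thesis
    proof (cases "\<exists>p u. (q, a, p, u) \<in> T")
      case True
      then obtain p u where t: "(q, a, p, u) \<in> T" by blast
      have "scan T F p x (u @ w) = Some (y, v)" using Cons.prems(1) scan_trans[OF assms(5) t 3] by simp
      then show ?thesis using Cons.IH[of p "u @ w"] Cons.prems(2,3) assms(4)[OF t] by auto
    next
      case False
      then show ?thesis using Cons.prems(1) scan_no_trans[OF _ 3, of q a T F] by auto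
    qed
  qed
qed

lemma less_power_floorlog: "x < 2 ^ floorlog 2 x"
  using floorlog_bounds[of x 2] by (cases "x = 0") auto

lemma floorlog_le_log: "0 < x \<Longrightarrow> real (floorlog 2 x) \<le> log 2 (real x) + 1"
  by (simp add: floorlog_def)

lemma run_imp_accepts: "run p s M x \<omega> (\<sigma>, \<omega>') \<Longrightarrow> \<sigma> 1 \<noteq> 0 \<Longrightarrow> accepts p M x \<omega>"
  unfolding accepts_def by blast

lemma run_imp_rejects: "run p s M x \<omega> (\<sigma>, \<omega>') \<Longrightarrow> \<sigma> 1 = 0 \<Longrightarrow> rejects p M x \<omega>"
  unfolding rejects_def by blast

text \<open>\<open>K\<close> exceeds all state numbers, letter codes and lengths of pushed words. It
  does not depend on the input length, so the asymptotic bounds absorb it; it is also the base of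
  the exact hash.\<close>

locale automaton =
  fixes c :: "'a \<Rightarrow> nat" and A :: "'a set" and ts :: "'a trans list" and fs :: "nat list"
    and q0 K :: nat
  assumes det: "deterministic (set ts)"
    and ts: "\<And>p a p' u. (p, a, p', u) \<in> set ts \<Longrightarrow>
      2 \<le> p \<and> 2 \<le> p' \<and> p < K \<and> p' < K \<and> length u < K \<and> set u \<subseteq> A"
    and fs: "\<And>p. p \<in> set fs \<Longrightarrow> 2 \<le> p \<and> p < K"
    and q0: "2 \<le> q0" "q0 < K"
    and code: "\<And>a. a \<in> A \<Longrightarrow> c a < K"
    and inj: "inj_on c A"
begin

definition lang :: "'a list set" where
  "lang = {x \<in> lists A. \<exists>y. scan (set ts) (set fs) q0 x [] = Some (y, y)}"

lemma scanD:
  assumes "x \<in> lists A" "scan (set ts) (set fs) q0 x [] = Some (y, w)"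
  shows "length y = length w \<and> length w \<le> length x \<and> set y \<subseteq> A \<and> set w \<subseteq> A"
  using scan_Some[OF assms(2), of A] assms(1) ts det by (auto simp: in_lists_conv_set)

lemma hashes_agree_if_mem:
  assumes "x \<in> lang"
  shows "hashes_agree c ts fs q0 q r lo hi x"
  using assms unfolding lang_def hashes_agree_def by auto

text \<open>With modulus 0 and base \<open>K\<close> each window is compared exactly, and the
  \<open>p\<close> windows cover all positions.\<close>

lemma mem_if_hashes_agree:
  assumes "x \<in> lists A" "0 < p" "0 < l" "length x \<le> p * l"
    "\<And>k. k < p \<Longrightarrow> hashes_agree c ts fs q0 0 K (k * l) (k * l + l) x"
  shows "x \<in> lang"
proof -
  obtain y w where s: "scan (set ts) (set fs) q0 x [] = Some (y, w)"
    using assms(5)[OF assms(2)] unfolding hashes_agree_def by blast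
  note d = scanD[OF assms(1) s]
  have "hash c K (k * l) (k * l + l) (length x - length w) y = hash c K (k * l) (k * l + l) (length x - length w) w"
    if "k < p" for k
    using assms(5)[OF that] s unfolding hashes_agree_def by auto
  then have "y = w"
    by (rule eq_if_hash_windows_eq[where A = A and i = "length x - length w"]) (use d inj code assms(3,4) in auto)
  then show ?thesis using s assms(1) by (simp add: lang_def)
qed

text \<open>The suffixes \<open>y\<close> and \<open>w\<close> do not depend on \<open>r\<close>, so
  this counts collisions of two fixed words; K \<le> q keeps letter codes distinct modulo
  \<open>q\<close>.\<close>

lemma card_hashes_agree:
  assumes "x \<in> lists A" "x \<notin> lang" "prime q" "K \<le> q"
  shows "card {r. r < q \<and> hashes_agree c ts fs q0 q r 0 (length x) x} \<le> length x"
proof (cases "scan (set ts) (set fs) q0 x []")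
  case None
  then show ?thesis by (simp add: hashes_agree_def)
next
  case (Some yw)
  then obtain y w where s: "scan (set ts) (set fs) q0 x [] = Some (y, w)" by (cases yw) auto
  note d = scanD[OF assms(1) s]
  have "y \<noteq> w" using s assms(1,2) by (auto simp: lang_def)
  have "{r. r < q \<and> hashes_agree c ts fs q0 q r 0 (length x) x} =
    {r. r < q \<and> hash c r 0 (length x) (length x - length w) y mod q = hash c r 0 (length x) (length x - length w) w mod q}"
    using s by (auto simp: hashes_agree_def)
  also have "card \<dots> \<le> length x"
    by (rule card_hash_collisions[where A = A])
       (use \<open>y \<noteq> w\<close> d assms(3,4) code inj in \<open>auto intro: less_le_trans\<close>)
  finally show ?thesis .
qed

lemma K_ge: "3 \<le> K" using q0 by simp

subsection \<open>Deterministic algorithm with p passes\<close>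

text \<open>Positive even for \<open>n\<close> = 0 or p > n, and \<open>p\<close> such windows cover
  more than \<open>n\<close> positions.\<close>

definition det_width :: "nat \<Rightarrow> nat \<Rightarrow> nat" where
  "det_width p n = n div p + 1"

text \<open>The first summand is for the hashes: a hash plus a further contribution is below 2 K^l,
  at most K^(l+1), with l the width. The second is for states, \<open>p\<close> and the counters, of
  which \<open>rHi\<close> reaches (p + 1) l \<le> 2n + p + 1.\<close>

definition det_bits :: "nat \<Rightarrow> nat \<Rightarrow> nat" where
  "det_bits p n = floorlog 2 K * (det_width p n + 1) + floorlog 2 (2 * n + p + K + 3)"

lemma det_bits_ge:
  "2 * n + p + K + 3 < 2 ^ det_bits p n" "K ^ (det_width p n + 1) < 2 ^ det_bits p n"
proof -
  have 1: "2 * n + p + K + 3 < 2 ^ floorlog 2 (2 * n + p + K + 3)" by (rule less_power_floorlog)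
  have "K ^ (det_width p n + 1) \<le> (2 ^ floorlog 2 K) ^ (det_width p n + 1)"
    using less_power_floorlog[of K] by (intro power_mono) auto
  then have 2: "K ^ (det_width p n + 1) \<le> 2 ^ (floorlog 2 K * (det_width p n + 1))"
    by (simp only: power_mult)
  have pos: "(1::nat) \<le> 2 ^ (floorlog 2 K * (det_width p n + 1))" by simp
  show "2 * n + p + K + 3 < 2 ^ det_bits p n"
    using less_le_trans[OF 1] mult_right_mono[OF pos, of "2 ^ floorlog 2 (2 * n + p + K + 3)"]
    by (simp add: det_bits_def power_add)
  have "K ^ (det_width p n + 1) * 1 < 2 ^ (floorlog 2 K * (det_width p n + 1)) * 2 ^ floorlog 2 (2 * n + p + K + 3)"
    by (rule mult_le_less_imp_less[OF 2]) (use 1 K_ge in auto)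
  then show "K ^ (det_width p n + 1) < 2 ^ det_bits p n"
    by (simp add: det_bits_def power_add)
qed

lemma streaming_det: "streaming c A ts fs q0 (det_bits p n) n 0 K (det_width p n)"
proof
  note b = det_bits_ge[where n = n and p = p]
  show "0 < det_bits p n" using b(1) by (cases "det_bits p n") auto
  show "deterministic (set ts)" by (rule det)
  show "2 \<le> q0" "q0 < 2 ^ det_bits p n" using q0 b(1) by linarith+
  show "n + 1 < 2 ^ det_bits p n" using b(1) by linarith
  show "2 \<le> x \<and> 2 \<le> x' \<and> x < 2 ^ det_bits p n \<and> x' < 2 ^ det_bits p n \<and>
      length u + n < 2 ^ det_bits p n \<and> set u \<subseteq> A" if "(x, a, x', u) \<in> set ts" for x a x' u
    using ts[OF that] b(1) by linarith
  show "2 \<le> x \<and> x < 2 ^ det_bits p n" if "x \<in> set fs" for x using fs[OF that] b(1) by linarith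
  show "c a < 2 ^ det_bits p n" if "a \<in> A" for a using code[OF that] b(1) by linarith
  have pow: "K ^ d * K \<le> K ^ det_width p n" if "d < det_width p n" for d
    using power_increasing[of "Suc d" "det_width p n" K] that K_ge by (simp add: mult.commute)
  have twice: "2 * K ^ det_width p n < 2 ^ det_bits p n"
  proof -
    have "2 * K ^ det_width p n \<le> K ^ (det_width p n + 1)" using K_ge by simp
    then show ?thesis using b(2) by linarith
  qed
  show "K ^ d mod 0 * K < 2 ^ det_bits p n" if "d < det_width p n" for d
    using pow[OF that] twice by simp
  show "hash c K lo (lo + det_width p n) i z mod 0 + K ^ d mod 0 * c a < 2 ^ det_bits p n"
    if "d < det_width p n" "a \<in> A" "set z \<subseteq> A" for d lo i z a
  proof -
    have "hash c K lo (lo + det_width p n) i z < K ^ (lo + det_width p n - lo)"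
      by (rule hash_less) (use that code K_ge in auto)
    then have "hash c K lo (lo + det_width p n) i z < K ^ det_width p n" by simp
    moreover have "K ^ d * c a \<le> K ^ d * K" using code[OF that(2)] by (intro mult_left_mono) auto
    ultimately show ?thesis unfolding mod_by_0 using pow[OF that(1)] twice by linarith
  qed
qed

definition det_alg :: "nat \<Rightarrow> 'a stream_alg" where
  "det_alg p = algorithm (init_det p K) c ts fs q0"

lemma det_alg_run:
  assumes "0 < p" "x \<in> lists A"
  shows "\<exists>\<sigma>. run p (17 * det_bits p (length x)) (det_alg p) x [] (\<sigma>, []) \<and> (\<sigma> 1 \<noteq> 0 \<longleftrightarrow> x \<in> lang)"
proof -
  let ?n = "length x" and ?m = "det_bits p (length x)" and ?l = "det_width p (length x)"
  interpret streaming c A ts fs q0 ?m ?n 0 K ?l by (rule streaming_det)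
  note b = det_bits_ge[where n = ?n and p = p]
  have div: "p * (?n div p) \<le> ?n" "?n div p \<le> ?n" by simp_all
  have "(p + 1) * ?l = p * (?n div p) + ?n div p + p + 1"
    by (simp add: det_width_def algebra_simps)
  moreover have "?l = ?n div p + 1" by (simp add: det_width_def)
  ultimately have l: "(p + 1) * ?l < 2 ^ ?m" "?l < 2 ^ ?m"
    using b(1) div by linarith+
  have le: "?n \<le> p * ?l"
  proof -
    have "?n = p * (?n div p) + ?n mod p" "p * ?l = p * (?n div p) + p"
      by (simp_all add: det_width_def)
    then show ?thesis using mod_less_divisor[OF assms(1), of ?n] by linarith
  qed
  have width: "Suc (?n div p) = ?l" by (simp add: det_width_def)
  have lt: "(1::nat) < 2 ^ ?m" "p < 2 ^ ?m" "K < 2 ^ ?m" using b(1) by linarith+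
  have bnd: "bnd ?m (initial_store ?n)" using b(1) by (auto simp: bnd_def initial_store_def)
  have "wp ?m (init_det p K) (\<lambda>(\<sigma>, \<omega>). \<omega> = [] \<and> base 0 1 \<sigma>) (initial_store ?n, [])"
    unfolding init_det_def
    by (intro wp_Seq wp_Const wp_Add wp_Div)
       (use lt l(2) m width in \<open>auto simp: initial_store_def base_def clean_def\<close>)
  then obtain \<sigma> where 1: "exec 17 (17 * ?m) (init_det p K) (initial_store ?n, []) (\<sigma>, [])" "bnd ?m \<sigma>" "base 0 1 \<sigma>"
    using bnd unfolding wp_def by auto
  have x: "set x \<subseteq> A" using assms(2) by auto
  obtain \<sigma>' where 2: "run p (17 * ?m) (det_alg p) x [] (\<sigma>', [])"
    "\<sigma>' 1 \<noteq> 0 \<longleftrightarrow> (\<forall>k<p. hashes_agree c ts fs q0 0 K (k * ?l) (k * ?l + ?l) x)"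
    using run_algorithm[OF 1 x refl l(1)] unfolding det_alg_def by blast
  have "(\<forall>k<p. hashes_agree c ts fs q0 0 K (k * ?l) (k * ?l + ?l) x) \<longleftrightarrow> x \<in> lang"
    using mem_if_hashes_agree[OF assms(2,1) _ le] hashes_agree_if_mem by (auto simp: det_width_def)
  then show ?thesis using 2 by blast
qed

text \<open>The assumption makes n / p at least log n and so at least 1; it absorbs the counters and
  all additive constants. In particular p \<le> n, hence 2n + p + K + 3 \<le> (K + 6) n. The
  resulting factor does not depend on \<open>p\<close>.\<close>

lemma det_bits_bound:
  assumes "0 < p" "2 \<le> n" "real p * log 2 (real n) \<le> real n"
  shows "real (17 * det_bits p n) \<le> 17 * (3 * real (floorlog 2 K) + log 2 (real K + 6) + 2) * (real n / real p)"
proof -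
  let ?X = "real n / real p" and ?e = "real (floorlog 2 K)"
  have log1: "1 \<le> log 2 (real n)" using assms(2) by (simp add: le_log_iff)
  have X: "log 2 (real n) \<le> ?X" using assms(1,3) by (simp add: field_simps)
  then have X1: "1 \<le> ?X" using log1 by linarith
  then have pn: "p \<le> n" using assms(1) by (simp add: field_simps)
  have "real (n div p) \<le> ?X" by (rule of_nat_div_le_of_nat)
  then have "real (det_width p n + 1) \<le> 3 * ?X" using X1 by (simp add: det_width_def)
  then have 1: "?e * real (det_width p n + 1) \<le> 3 * ?e * ?X"
    using mult_left_mono[of "real (det_width p n + 1)" "3 * ?X" ?e] by (simp add: algebra_simps)
  have "real (2 * n + p + K + 3) \<le> (real K + 6) * real n"
  proof -
    have "real K * 1 \<le> real K * real n" using assms(2) by (intro mult_left_mono) auto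
    moreover have "real p \<le> real n" "3 \<le> 3 * real n" using pn assms(2) by auto
    ultimately show ?thesis by (simp add: algebra_simps)
  qed
  then have "log 2 (real (2 * n + p + K + 3)) \<le> log 2 ((real K + 6) * real n)"
    by (intro log_mono) auto
  also have "\<dots> = log 2 (real K + 6) + log 2 (real n)"
    using assms(2) by (intro log_mult_pos) auto
  finally have "real (floorlog 2 (2 * n + p + K + 3)) \<le> log 2 (real K + 6) + log 2 (real n) + 1"
    using floorlog_le_log[of "2 * n + p + K + 3"] by linarith
  moreover have "0 \<le> log 2 (real K + 6)" by simp
  then have "log 2 (real K + 6) * 1 \<le> log 2 (real K + 6) * ?X" by (intro mult_left_mono X1)
  ultimately have "real (floorlog 2 (2 * n + p + K + 3)) \<le> (log 2 (real K + 6) + 2) * ?X"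
    using X X1 unfolding distrib_right by linarith
  with 1 have "?e * real (det_width p n + 1) + real (floorlog 2 (2 * n + p + K + 3))
      \<le> (3 * ?e + log 2 (real K + 6) + 2) * ?X"
    unfolding distrib_right by linarith
  then have "real (det_bits p n) \<le> (3 * ?e + log 2 (real K + 6) + 2) * ?X"
    by (simp only: det_bits_def of_nat_add of_nat_mult)
  then show ?thesis unfolding of_nat_mult of_nat_numeral mult.assoc[of 17] by (rule mult_left_mono) simp
qed

lemma deterministic_part:
  "\<exists>C::real. \<forall>p::nat. 0 < p \<longrightarrow>
    (\<exists>M s. deterministic_streaming_alg A p M s \<and>
       (\<forall>x \<in> lists A. (x \<in> lang \<longrightarrow> accepts p M x []) \<and> (x \<notin> lang \<longrightarrow> rejects p M x [])) \<and>
       (\<forall>n\<ge>2. real p * log 2 (real n) \<le> real n \<longrightarrow> real (s n) \<le> C * (real n / real p)))"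
proof (intro exI allI impI conjI)
  fix p :: nat assume p: "0 < p"
  show "deterministic_streaming_alg A p (det_alg p) (\<lambda>n. 17 * det_bits p n)"
    unfolding deterministic_streaming_alg_def streaming_alg_def using det_alg_run[OF p] by fastforce
  show "\<forall>x \<in> lists A. (x \<in> lang \<longrightarrow> accepts p (det_alg p) x []) \<and> (x \<notin> lang \<longrightarrow> rejects p (det_alg p) x [])"
  proof
    fix x assume "x \<in> lists A"
    then obtain \<sigma> where "run p (17 * det_bits p (length x)) (det_alg p) x [] (\<sigma>, [])" "\<sigma> 1 \<noteq> 0 \<longleftrightarrow> x \<in> lang"
      using det_alg_run[OF p] by blast
    then show "(x \<in> lang \<longrightarrow> accepts p (det_alg p) x []) \<and> (x \<notin> lang \<longrightarrow> rejects p (det_alg p) x [])"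
      using run_imp_accepts run_imp_rejects by metis
  qed
qed (rule det_bits_bound)

subsection \<open>Randomized algorithm with one pass\<close>

text \<open>
  The square makes the collision probability at most \<open>1 / n\<close>; \<open>K\<close> makes the prime exceed all
  letter codes, so that distinct letters stay distinct modulo it.
\<close>

definition rand_target :: "nat \<Rightarrow> nat" where
  "rand_target n = n * n + K"

definition num_bits :: "nat \<Rightarrow> nat" where
  "num_bits n = (LEAST t. rand_target n \<le> 2 ^ t)"

definition rand_prime :: "nat \<Rightarrow> nat" where
  "rand_prime n = (LEAST q. prime q \<and> 2 ^ num_bits n < q)"

text \<open>With T the target, the prime is at most 8 T^2. The largest intermediate results, a
  residue plus a product, are at most twice its square, and 2 (8 T^2)^2 = 128 T^4.\<close>

definition rand_bits :: "nat \<Rightarrow> nat" where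
  "rand_bits n = floorlog 2 (128 * rand_target n ^ 4)"

definition init_rand :: com where
  "init_rand = Const rVerdict 1 ;; Const rOne 1 ;; Const rC K ;; Op rA Mul rLen rLen ;;
     Op rC Add rA rC ;; Const rMod 1 ;; Op rA Sub rC rMod ;; draw_bits ;; Const rC 1 ;;
     next_prime ;; Const rB 0 ;; Op rWidth Add rLen rA ;; Op rHi Add rLen rA"

definition rand_alg :: "'a stream_alg" where
  "rand_alg = algorithm init_rand c ts fs q0"

lemma num_bits:
  "rand_target n \<le> 2 ^ num_bits n" "j < num_bits n \<Longrightarrow> 2 ^ j < rand_target n"
  "2 ^ num_bits n + 1 \<le> 2 * rand_target n"
proof -
  have "rand_target n \<le> 2 ^ rand_target n" by (simp add: less_imp_le)
  then show le: "rand_target n \<le> 2 ^ num_bits n" unfolding num_bits_def by (rule LeastI)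
  show less: "2 ^ j < rand_target n" if "j < num_bits n" for j
    using not_less_Least[of j "\<lambda>t. rand_target n \<le> 2 ^ t"] that by (simp add: num_bits_def)
  have "num_bits n \<noteq> 0" using le K_ge by (cases "num_bits n = 0") (auto simp: rand_target_def)
  then obtain t where t: "num_bits n = Suc t" using not0_implies_Suc by blast
  show "2 ^ num_bits n + 1 \<le> 2 * rand_target n" using less[of t] t by simp
qed

text \<open>The bound is \<open>prime_between_square\<close> at N =
  \<open>2 ^ num_bits n + 1\<close>, which is at most twice the target since
  \<open>num_bits n\<close> is minimal.\<close>

lemma rand_prime:
  "prime (rand_prime n)" "2 ^ num_bits n < rand_prime n"
  "prime q \<Longrightarrow> 2 ^ num_bits n < q \<Longrightarrow> rand_prime n \<le> q"
  "rand_prime n \<le> 8 * (rand_target n)\<^sup>2"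
proof -
  let ?N = "2 ^ num_bits n + 1 :: nat"
  have N: "3 \<le> rand_target n" using K_ge by (simp add: rand_target_def)
  then have "3 \<le> ?N" using num_bits(1)[of n] by linarith
  then obtain p where p: "prime p" "?N \<le> p" "p \<le> 2 * ?N\<^sup>2" using prime_between_square by blast
  then have ex: "prime p \<and> 2 ^ num_bits n < p" by simp
  from LeastI[of "\<lambda>q. prime q \<and> 2 ^ num_bits n < q", OF ex]
  show "prime (rand_prime n)" "2 ^ num_bits n < rand_prime n" unfolding rand_prime_def by auto
  show least: "rand_prime n \<le> q" if "prime q" "2 ^ num_bits n < q" for q
    unfolding rand_prime_def using that by (intro Least_le conjI)
  have "?N\<^sup>2 \<le> (2 * rand_target n)\<^sup>2" using num_bits(3) by (rule power_mono) simp
  then have "2 * ?N\<^sup>2 \<le> 8 * (rand_target n)\<^sup>2" by (simp add: power_mult_distrib)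
  then show "rand_prime n \<le> 8 * (rand_target n)\<^sup>2" using least[of p] ex p(3) by linarith
qed

lemma rand_bits_gt: "2 * (rand_prime n * rand_prime n) < 2 ^ rand_bits n"
proof -
  have "rand_prime n * rand_prime n \<le> (8 * (rand_target n)\<^sup>2) * (8 * (rand_target n)\<^sup>2)"
    by (intro mult_mono rand_prime(4)) auto
  also have "\<dots> = 64 * rand_target n ^ 4" by (simp add: power2_eq_square power4_eq_xxxx)
  finally show ?thesis using less_power_floorlog[of "128 * rand_target n ^ 4"]
    by (simp add: rand_bits_def)
qed

lemma rand_bounds:
  "K + n < rand_prime n" "n * n + K < rand_prime n"
  "x \<le> 2 * (rand_prime n * rand_prime n) \<Longrightarrow> x < 2 ^ rand_bits n"
  "2 * rand_prime n \<le> rand_prime n * rand_prime n"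
proof -
  show *: "n * n + K < rand_prime n"
    using num_bits(1)[of n] rand_prime(2)[of n] by (simp add: rand_target_def)
  have "n \<le> n * n" by (cases n) auto
  then show "K + n < rand_prime n" using * by linarith
  show "x < 2 ^ rand_bits n" if "x \<le> 2 * (rand_prime n * rand_prime n)"
    using that rand_bits_gt[of n] by linarith
  have "2 \<le> rand_prime n" using * K_ge by linarith
  then show "2 * rand_prime n \<le> rand_prime n * rand_prime n" by (intro mult_right_mono) auto
qed

lemma streaming_rand:
  assumes "r < rand_prime n"
  shows "streaming c A ts fs q0 (rand_bits n) n (rand_prime n) r n"
proof
  let ?q = "rand_prime n" and ?m = "rand_bits n"
  note b = rand_bounds(1,2)[of n]
  have q: "2 * ?q \<le> ?q * ?q" by (rule rand_bounds)
  have small: "x < 2 ^ ?m" if "x \<le> 2 * ?q" for x using rand_bounds(3)[of x n] that q by linarith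
  show "0 < ?m" using small[of 1] K_ge b by (cases "?m") auto
  show "deterministic (set ts)" by (rule det)
  show "2 \<le> q0" by (rule q0)
  show "q0 < 2 ^ ?m" by (rule small) (use q0 b in linarith)
  show "n + 1 < 2 ^ ?m" by (rule small) (use K_ge b in linarith)
  show "2 \<le> x \<and> 2 \<le> x' \<and> x < 2 ^ ?m \<and> x' < 2 ^ ?m \<and> length u + n < 2 ^ ?m \<and> set u \<subseteq> A"
    if "(x, a, x', u) \<in> set ts" for x a x' u
    using ts[OF that] b small[of x] small[of x'] small[of "length u + n"] by linarith
  show "2 \<le> x \<and> x < 2 ^ ?m" if "x \<in> set fs" for x using fs[OF that] b small[of x] by linarith
  show "c a < 2 ^ ?m" if "a \<in> A" for a using code[OF that] b small[of "c a"] by linarith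
  have mod: "x mod ?q < ?q" for x using b by simp
  show "r ^ d mod ?q * r < 2 ^ ?m" for d
  proof (rule rand_bounds(3))
    have "r ^ d mod ?q * r \<le> ?q * ?q" using mod[of "r ^ d"] assms by (intro mult_mono) auto
    then show "r ^ d mod ?q * r \<le> 2 * (?q * ?q)" by linarith
  qed
  show "hash c r lo (lo + n) i z mod ?q + r ^ d mod ?q * c a < 2 ^ ?m"
    if "a \<in> A" for d lo i z a
  proof (rule rand_bounds(3))
    have "r ^ d mod ?q * c a \<le> ?q * ?q" using mod[of "r ^ d"] code[OF that] b by (intro mult_mono) auto
    then show "hash c r lo (lo + n) i z mod ?q + r ^ d mod ?q * c a \<le> 2 * (?q * ?q)"
      using mod[of "hash c r lo (lo + n) i z"] q by linarith
  qed
qed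

lemma rand_alg_run:
  assumes "x \<in> lists A" "length \<omega> = num_bits (length x)"
  shows "\<exists>\<sigma>. run 1 (17 * rand_bits (length x)) rand_alg x \<omega> (\<sigma>, []) \<and>
    (\<sigma> 1 \<noteq> 0 \<longleftrightarrow> hashes_agree c ts fs q0 (rand_prime (length x)) (val \<omega>) 0 (length x) x)"
proof -
  let ?n = "length x" and ?m = "rand_bits (length x)" and ?q = "rand_prime (length x)"
  have "val \<omega> < ?q" using val_less[of \<omega>] rand_prime(2)[of ?n] assms(2) by simp
  then interpret streaming c A ts fs q0 ?m ?n ?q "val \<omega>" ?n by (rule streaming_rand)
  note b = rand_bounds(1,2)[of ?n]
  have q: "2 * ?q \<le> ?q * ?q" by (rule rand_bounds)
  have small: "y < 2 ^ ?m" if "y \<le> 2 * ?q" for y using rand_bounds(3)[of y ?n] that q by linarith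
  have lt: "(1::nat) < 2 ^ ?m" "K < 2 ^ ?m" "?n * ?n < 2 ^ ?m" "?n * ?n + K < 2 ^ ?m" "?n < 2 ^ ?m" "?q < 2 ^ ?m"
    "2 ^ num_bits ?n < (2::nat) ^ ?m" "2 * ?n < 2 ^ ?m"
    by (rule small, use b K_ge rand_prime(2)[of ?n] in linarith)+
  have bnd: "bnd ?m (initial_store ?n)" using lt by (auto simp: bnd_def initial_store_def)
  have pow: "1 \<le> (2::nat) ^ num_bits ?n" by simp
  have "wp ?m init_rand (\<lambda>(\<sigma>, \<omega>). \<omega> = [] \<and> base 0 1 \<sigma>) (initial_store ?n, \<omega>)"
    unfolding init_rand_def
    by (intro wp_Seq wp_Const wp_Add wp_Mul wp_Sub
        wp_draw_bits[OF m lt(7) assms(2) num_bits(1) num_bits(2)]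
        wp_next_prime[OF m lt(6) rand_prime(1) rand_prime(2) rand_prime(3) pow])
       (use lt m in \<open>auto simp: initial_store_def base_def clean_def rand_target_def\<close>)
  then obtain \<sigma> where 1: "exec 17 (17 * ?m) init_rand (initial_store ?n, \<omega>) (\<sigma>, [])" "bnd ?m \<sigma>" "base 0 1 \<sigma>"
    using bnd unfolding wp_def by auto
  have x: "set x \<subseteq> A" using assms(1) by auto
  show ?thesis
    using run_algorithm[OF 1 x refl, of 1] lt(8) unfolding rand_alg_def by simp
qed

lemma rand_bits_bigo: "(\<lambda>n. real (17 * rand_bits n)) \<in> O(\<lambda>n. log 2 (real n))"
proof (rule bigoI)
  \<comment> \<open>The target is at most (1 + K) n^2, so its fourth power contributes 8 log n; the
    rounding in \<open>floorlog\<close> adds 1. From n = 2 on, log n \<ge> 1 absorbs the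
    constants.\<close>
  let ?C = "log 2 (128 * (1 + real K) ^ 4) + 9"
  show "\<forall>\<^sub>F n in at_top. norm (real (17 * rand_bits n)) \<le> 17 * ?C * norm (log 2 (real n))"
    using eventually_ge_at_top[of 2]
  proof eventually_elim
    case (elim n)
    have log1: "1 \<le> log 2 (real n)" using elim by (simp add: le_log_iff)
    have pos: "0 < rand_target n" using K_ge by (simp add: rand_target_def)
    have "real (rand_target n) \<le> (1 + real K) * real n ^ 2"
    proof -
      have "real K * 1 \<le> real K * real n ^ 2" using elim by (intro mult_left_mono) (auto intro: one_le_power)
      then show ?thesis by (simp add: rand_target_def algebra_simps power2_eq_square)
    qed
    then have "real (rand_target n) ^ 4 \<le> ((1 + real K) * real n ^ 2) ^ 4" by (intro power_mono) auto
    then have "real (128 * rand_target n ^ 4) \<le> (128 * (1 + real K) ^ 4) * real n ^ 8"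
      by (simp add: power_mult_distrib flip: power_mult)
    then have "log 2 (real (128 * rand_target n ^ 4)) \<le> log 2 ((128 * (1 + real K) ^ 4) * real n ^ 8)"
      using pos by (intro log_mono) auto
    also have "\<dots> = log 2 (128 * (1 + real K) ^ 4) + 8 * log 2 (real n)"
      using elim by (subst log_mult_pos) (auto simp: log_nat_power)
    finally have "real (rand_bits n) \<le> log 2 (128 * (1 + real K) ^ 4) + 8 * log 2 (real n) + 1"
      using floorlog_le_log[of "128 * rand_target n ^ 4"] pos by (simp add: rand_bits_def)
    moreover have "0 \<le> log 2 (128 * (1 + real K) ^ 4)"
    proof -
      have "(1::real) \<le> (1 + real K) ^ 4" by (rule one_le_power) simp
      then have "1 \<le> 128 * (1 + real K) ^ 4" by linarith
      then show ?thesis by (subst zero_le_log_cancel_iff) linarith+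
    qed
    then have "log 2 (128 * (1 + real K) ^ 4) * 1 \<le> log 2 (128 * (1 + real K) ^ 4) * log 2 (real n)"
      using log1 by (intro mult_left_mono)
    ultimately have "real (rand_bits n) \<le> ?C * log 2 (real n)"
      using log1 by (simp add: algebra_simps)
    then have "17 * real (rand_bits n) \<le> 17 * ?C * log 2 (real n)"
      unfolding mult.assoc by (rule mult_left_mono) simp
    then show ?case using log1 by simp
  qed
qed

section \<open>Error probability\<close>

lemma prob_random_bits:
  "measure_pmf.prob (random_bits t) S = real (card {\<omega> \<in> S. length \<omega> = t}) / 2 ^ t"
proof -
  have fin: "finite {\<omega>::bool list. length \<omega> = t}" and card: "card {\<omega>::bool list. length \<omega> = t} = 2 ^ t"
    using finite_lists_length_eq[of "UNIV :: bool set" t] card_lists_length_eq[of "UNIV :: bool set" t]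
    by (simp_all add: card_UNIV_bool)
  have "replicate t True \<in> {\<omega>::bool list. length \<omega> = t}" by simp
  then have ne: "{\<omega>::bool list. length \<omega> = t} \<noteq> {}" by blast
  have "{\<omega>. length \<omega> = t} \<inter> S = {\<omega> \<in> S. length \<omega> = t}" by auto
  then show ?thesis unfolding random_bits_def measure_pmf_of_set[OF ne fin] card by simp
qed

text \<open>For a word outside the language, at most n of the 2^t bit strings lead to agreement, and
  2^t \<ge> n^2 makes this fraction at most 1 / n.\<close>

lemma randomized_part:
  "\<exists>M s b. streaming_alg A 1 M s b \<and> (\<lambda>n. real (s n)) \<in> O(\<lambda>n. log 2 (real n)) \<and>
    (\<forall>n. \<forall>x \<in> lists A. length x = n \<longrightarrow>
      (x \<in> lang \<longrightarrow> measure_pmf.prob (random_bits (b n)) {\<omega>. accepts 1 M x \<omega>} = 1) \<and>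
      (x \<notin> lang \<longrightarrow> 0 < n \<longrightarrow>
        measure_pmf.prob (random_bits (b n)) {\<omega>. rejects 1 M x \<omega>} \<ge> 1 - 1 / real n))"
proof (intro exI conjI allI ballI impI)
  show "streaming_alg A 1 rand_alg (\<lambda>n. 17 * rand_bits n) num_bits"
    unfolding streaming_alg_def using rand_alg_run by blast
  show "(\<lambda>n. real (17 * rand_bits n)) \<in> O(\<lambda>n. log 2 (real n))" by (rule rand_bits_bigo)
next
  fix n x assume x: "x \<in> lists A" "length x = n"
  let ?t = "num_bits n"
  have all: "card {\<omega>::bool list. length \<omega> = ?t} = 2 ^ ?t"
    using card_lists_length_eq[of "UNIV :: bool set" ?t] by (simp add: card_UNIV_bool)
  {
    assume "x \<in> lang"
    then have "accepts 1 rand_alg x \<omega>" if "length \<omega> = ?t" for \<omega>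
      using rand_alg_run[OF x(1), of \<omega>] hashes_agree_if_mem that x(2) run_imp_accepts by metis
    then have "{\<omega> \<in> {\<omega>. accepts 1 rand_alg x \<omega>}. length \<omega> = ?t} = {\<omega>. length \<omega> = ?t}" by auto
    then show "measure_pmf.prob (random_bits ?t) {\<omega>. accepts 1 rand_alg x \<omega>} = 1"
      unfolding prob_random_bits by (simp add: all)
  }
  assume notin: "x \<notin> lang" and n: "0 < n"
  let ?q = "rand_prime n"
  let ?agree = "{\<omega>. length \<omega> = ?t \<and> hashes_agree c ts fs q0 ?q (val \<omega>) 0 n x}"
  let ?reject = "{\<omega> \<in> {\<omega>. rejects 1 rand_alg x \<omega>}. length \<omega> = ?t}"
  have fin: "finite {\<omega>::bool list. length \<omega> = ?t}"
    using finite_lists_length_eq[of "UNIV :: bool set" ?t] by simp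
  have "{\<omega>. length \<omega> = ?t} - ?agree \<subseteq> ?reject"
    using rand_alg_run[OF x(1)] x(2) run_imp_rejects by fastforce
  then have "card ({\<omega>. length \<omega> = ?t} - ?agree) \<le> card ?reject"
    using fin by (intro card_mono) auto
  moreover have "card ({\<omega>. length \<omega> = ?t} - ?agree) = 2 ^ ?t - card ?agree"
    using fin unfolding all[symmetric] by (intro card_Diff_subset) (auto intro: finite_subset[OF _ fin])
  moreover have "card ?agree \<le> n"
  proof -
    have "card ?agree = card (val ` ?agree)"
      by (rule card_image[symmetric]) (auto simp: inj_on_def intro: val_inject)
    \<comment> \<open>The bits only reach points below \<open>2 ^ ?t\<close>; the bound on
      collisions holds for all residues modulo the prime.\<close>
    also have "\<dots> \<le> card {r. r < ?q \<and> hashes_agree c ts fs q0 ?q r 0 n x}"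
    proof (intro card_mono subsetI)
      fix r assume "r \<in> val ` ?agree"
      then obtain \<omega> where "r = val \<omega>" "\<omega> \<in> ?agree" by blast
      then show "r \<in> {r. r < ?q \<and> hashes_agree c ts fs q0 ?q r 0 n x}"
        using val_less[of \<omega>] rand_prime(2)[of n] by auto
    qed simp
    also have "\<dots> \<le> n"
      using card_hashes_agree[OF x(1) notin rand_prime(1)[of n]] rand_bounds(2)[of n] x(2) by simp
    finally show ?thesis .
  qed
  ultimately have "2 ^ ?t \<le> card ?reject + n" by linarith
  then have "real (2 ^ ?t) \<le> real (card ?reject + n)" using of_nat_le_iff by blast
  then have 1: "2 ^ ?t \<le> real (card ?reject) + real n" by simp
  have "n * n \<le> 2 ^ ?t" using num_bits(1)[of n] by (simp add: rand_target_def)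
  then have "real (n * n) \<le> real (2 ^ ?t)" using of_nat_le_iff by blast
  then have 2: "real n / 2 ^ ?t \<le> 1 / real n" using n by (simp add: field_simps)
  have "1 - 1 / real n \<le> 1 - real n / 2 ^ ?t" using 2 by simp
  also have "\<dots> \<le> real (card ?reject) / 2 ^ ?t"
    using divide_right_mono[OF 1, of "2 ^ ?t"] by (simp add: add_divide_distrib)
  finally show "measure_pmf.prob (random_bits ?t) {\<omega>. rejects 1 rand_alg x \<omega>} \<ge> 1 - 1 / real n"
    unfolding prob_random_bits by simp
qed

end

lemma finite_nat_bound:
  assumes "finite (X :: nat set)"
  shows "\<exists>k. \<forall>x\<in>X. x < k"
  using finite_nat_set_iff_bounded[of X] assms by auto

lemma DLIN_automaton:
  assumes "L \<in> DLIN A"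
  shows "\<exists>c ts fs q0 K. automaton c A ts fs q0 K \<and> L \<inter> lists A = automaton.lang A ts fs q0"
proof -
  obtain G :: "('a, nat) cfg" where G: "is_dl_cfg G" "terms G = A" "L = language G"
    using assms by (auto simp: DLIN_def)
  have "finite A" using G by (auto simp: is_dl_cfg_def is_cfg_def)
  then obtain c :: "'a \<Rightarrow> nat" where c: "inj_on c A" using finite_imp_inj_to_nat_seg by blast
  obtain ts where ts: "set ts = grammar_trans G" using finite_list[OF finite_grammar_trans[OF G(1)]] by blast
  obtain fs where fs: "set fs = grammar_final G" using finite_list[OF finite_grammar_final[OF G(1)]] by blast
  let ?X = "insert (start G + 3) (c ` A \<union> (\<lambda>(p, a, p', u). p) ` set ts \<union> (\<lambda>(p, a, p', u). p') ` set ts \<union>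
    (\<lambda>(p, a, p', u). length u) ` set ts \<union> set fs)"
  have "finite ?X" using \<open>finite A\<close> by simp
  then obtain K where K: "\<forall>x\<in>?X. x < K" using finite_nat_bound by blast
  have aut: "automaton c A ts fs (start G + 3) K"
  proof
    show "deterministic (set ts)" using deterministic_grammar_trans[OF G(1)] ts by simp
    show "2 \<le> p \<and> 2 \<le> p' \<and> p < K \<and> p' < K \<and> length u < K \<and> set u \<subseteq> A"
      if "(p, a, p', u) \<in> set ts" for p a p' u
    proof -
      have "2 \<le> p" "2 \<le> p'" using that ts by (auto simp: grammar_trans_def)
      moreover have "set u \<subseteq> A" using grammar_trans_word[OF G(1)] that ts G(2) by blast
      moreover have "p \<in> ?X" "p' \<in> ?X" "length u \<in> ?X" using that by force+
      ultimately show ?thesis using K by blast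
    qed
    show "2 \<le> p \<and> p < K" if "p \<in> set fs" for p
    proof -
      have "2 \<le> p" using that fs by (auto simp: grammar_final_def)
      then show ?thesis using K that by blast
    qed
    show "2 \<le> start G + 3" "start G + 3 < K" using K by auto
    show "c a < K" if "a \<in> A" for a using K that by blast
    show "inj_on c A" by (rule c)
  qed
  have "x \<in> L \<longleftrightarrow> (\<exists>y. scan (set ts) (set fs) (start G + 3) x [] = Some (y, y))" for x
    using gen_iff_scan[OF deterministic_grammar_trans[OF G(1)], of x "[]" "grammar_final G"] ts fs
      language_iff_gen[OF G(1), of x] G(3) by simp
  then have "L \<inter> lists A = automaton.lang A ts fs (start G + 3)"
    unfolding automaton.lang_def[OF aut] by blast
  with aut show ?thesis by blast
qed

theorem theorem1:
  fixes A :: "'a set" and L :: "'a list set"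
  assumes "L \<in> DLIN A"
  shows
    "(\<exists>M s b.
        streaming_alg A 1 M s b \<and>
        (\<lambda>n. real (s n)) \<in> O(\<lambda>n. log 2 (real n)) \<and>
        (\<forall>n. \<forall>x \<in> lists A. length x = n \<longrightarrow>
           (x \<in> L \<longrightarrow> measure_pmf.prob (random_bits (b n)) {\<omega>. accepts 1 M x \<omega>} = 1) \<and>
           (x \<notin> L \<longrightarrow> 0 < n \<longrightarrow>
              measure_pmf.prob (random_bits (b n)) {\<omega>. rejects 1 M x \<omega>} \<ge> 1 - 1 / real n))) \<and>
     (\<exists>C::real. \<forall>p::nat. 0 < p \<longrightarrow>
        (\<exists>M s.
           deterministic_streaming_alg A p M s \<and>
           (\<forall>x \<in> lists A.
              (x \<in> L \<longrightarrow> accepts p M x []) \<and> (x \<notin> L \<longrightarrow> rejects p M x [])) \<and>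
           (\<forall>n\<ge>2. real p * log 2 (real n) \<le> real n \<longrightarrow> real (s n) \<le> C * (real n / real p))))"
proof -
  obtain c ts fs q0 K where aut: "automaton c A ts fs q0 K"
    and L: "L \<inter> lists A = automaton.lang A ts fs q0"
    using DLIN_automaton[OF assms] by blast
  have mem: "x \<in> automaton.lang A ts fs q0 \<longleftrightarrow> x \<in> L" if "x \<in> lists A" for x
    using that unfolding L[symmetric] by blast
  show ?thesis
    using automaton.randomized_part[OF aut] automaton.deterministic_part[OF aut]
    by (simp only: mem cong: ball_cong conj_cong)
qed

end
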